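(* Let $W_\omega$ be a subnormal unilateral weighted shift with Berger measure $\sigma$, let $W_{(\alpha(\omega),\beta(\omega))}$ be a $(p,q)$-embedding of $W_\omega$, and let $f(r):=(p(r),q(r))$. Assume that $p\ge 0$ and $q\ge 0$ on $\operatorname{supp}\sigma$. Then the $2$-variable weighted shift $W_{(\alpha(\omega),\beta(\omega))}$ is (jointly) subnormal, with Berger measure $\mu:=\sigma\circ f^{-1}$, i.e. $\mu(E)=\sigma(f^{-1}(E))$ for all Borel sets $E\subseteq\mathbb{R}_+^2$.
   Context: $\mathbb{Z}_+=\{0,1,2,\dots\}$ and $\mathbb{R}_+=[0,\infty)$. Unilateral weighted shifts: for a bounded sequence $\omega=\{\omega_n\}_{n\ge0}$ of positive reals, $W_\omega$ acts on $\ell^2(\mathbb{Z}_+)$ by $W_\omega e_n=\omega_n e_{n+1}$; its moments are $\gamma_0:=1$, $\gamma_k:=\omega_0^2\cdots\omega_{k-1}^2$ ($k\ge1$). $W_\omega$ is subnormal (the restriction of a normal operator to an invariant subspace) if and only if there is a probability measure $\sigma$ on $[0,\|W_\omega\|^2]$, its Berger measure, with $\gamma_k=\int r^k\,d\sigma(r)$ for all $k\ge 0$. $2$-variable weighted shifts: for bounded families $\alpha_{\mathbf k},\beta_{\mathbf k}$ ($\mathbf k\in\mathbb{Z}_+^2$) of positive reals, $W_{(\alpha,\beta)}\equiv(T_1,T_2)$ acts on $\ell^2(\mathbb{Z}_+^2)$ by $T_1e_{\mathbf k}=\alpha_{\mathbf k}e_{\mathbf k+(1,0)}$, $T_2e_{\mathbf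 k}=\beta_{\mathbf k}e_{\mathbf k+(0,1)}$, and is assumed commuting: $\beta_{\mathbf k+(1,0)}\alpha_{\mathbf k}=\alpha_{\mathbf k+(0,1)}\beta_{\mathbf k}$. Its moment $\gamma_{(k_1,k_2)}$ is the product of the squares of the weights along any nondecreasing lattice path from $(0,0)$ to $(k_1,k_2)$. A commuting pair is (jointly) subnormal if it is the restriction of a commuting pair of normal operators to a common invariant subspace. $W_{(\alpha,\beta)}$ is subnormal if and only if there is a probability measure $\mu$ on $[0,\|T_1\|^2]\times[0,\|T_2\|^2]$, its Berger measure, with $\gamma_{(k_1,k_2)}=\int s^{k_1}t^{k_2}\,d\mu(s,t)$ for all $k_1,k_2\ge0$. Polynomial embedding: let $I\subseteq\mathbb{R}_+$ be a closed interval, $p,q$ real polynomials nonnegative on $I$ such that $f=(p,q):I\to\mathbb{R}_+^2$ is injective, and let $W_\omega$ be subnormal with Berger measure $\sigma$, $\operatorname{supp}\sigma\subseteq I$. The $(p,q)$-embedding of $W_\omega$, denoted $W_{(\alpha(\omega),\beta(\omega))}$, is the $2$-variable weighted shift with moments $\gamma_{(k_1,k_2)}=\int_I p(r)^{k_1}q(r)^{k_2}\,d\sigma(r)$, $k_1,k_2\ge0$. *)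

theory Defs
  imports "HOL-Analysis.Analysis" "HOL-Probability.Probability" "HOL-Computational_Algebra.Polynomial"
begin

section \<open>Complex Hilbert spaces and their operators\<close>

record 'a cspace =
  pts :: "'a set"
  vzero :: 'a
  vadd :: "'a \<Rightarrow> 'a \<Rightarrow> 'a"
  vscale :: "complex \<Rightarrow> 'a \<Rightarrow> 'a"
  vip :: "'a \<Rightarrow> 'a \<Rightarrow> complex"

definition vnorm :: "'a cspace \<Rightarrow> 'a \<Rightarrow> real" where
  "vnorm H x = sqrt (Re (vip H x x))"

definition vdist :: "'a cspace \<Rightarrow> 'a \<Rightarrow> 'a \<Rightarrow> real" where
  "vdist H x y = vnorm H (vadd H x (vscale H (- 1) y))"

text \<open>The inner product is linear in its first argument. Nothing is required outside \<open>pts H\<close>.\<close>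

locale complex_hilbert_space =
  fixes H :: "'a cspace"
  assumes zero_closed: "vzero H \<in> pts H"
    and add_closed: "\<lbrakk>x \<in> pts H; y \<in> pts H\<rbrakk> \<Longrightarrow> vadd H x y \<in> pts H"
    and scale_closed: "x \<in> pts H \<Longrightarrow> vscale H a x \<in> pts H"
    and add_assoc: "\<lbrakk>x \<in> pts H; y \<in> pts H; z \<in> pts H\<rbrakk>
          \<Longrightarrow> vadd H (vadd H x y) z = vadd H x (vadd H y z)"
    and add_commute: "\<lbrakk>x \<in> pts H; y \<in> pts H\<rbrakk> \<Longrightarrow> vadd H x y = vadd H y x"
    and add_zero: "x \<in> pts H \<Longrightarrow> vadd H x (vzero H) = x"
    and add_inverse: "x \<in> pts H \<Longrightarrow> \<exists>y\<in>pts H. vadd H x y = vzero H"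
    and scale_one: "x \<in> pts H \<Longrightarrow> vscale H 1 x = x"
    and scale_scale: "x \<in> pts H \<Longrightarrow> vscale H a (vscale H b x) = vscale H (a * b) x"
    and scale_add_left: "x \<in> pts H \<Longrightarrow> vscale H (a + b) x = vadd H (vscale H a x) (vscale H b x)"
    and scale_add_right: "\<lbrakk>x \<in> pts H; y \<in> pts H\<rbrakk>
          \<Longrightarrow> vscale H a (vadd H x y) = vadd H (vscale H a x) (vscale H a y)"
    and ip_add: "\<lbrakk>x \<in> pts H; y \<in> pts H; z \<in> pts H\<rbrakk>
          \<Longrightarrow> vip H (vadd H x y) z = vip H x z + vip H y z"
    and ip_scale: "\<lbrakk>x \<in> pts H; y \<in> pts H\<rbrakk> \<Longrightarrow> vip H (vscale H a x) y = a * vip H x y"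
    and ip_cnj: "\<lbrakk>x \<in> pts H; y \<in> pts H\<rbrakk> \<Longrightarrow> vip H y x = cnj (vip H x y)"
    and ip_nonneg: "x \<in> pts H \<Longrightarrow> 0 \<le> Re (vip H x x)"
    and ip_definite: "\<lbrakk>x \<in> pts H; vip H x x = 0\<rbrakk> \<Longrightarrow> x = vzero H"
    and complete: "Metric_space.mcomplete (pts H) (vdist H)"

definition linear_map :: "'a cspace \<Rightarrow> 'b cspace \<Rightarrow> ('a \<Rightarrow> 'b) \<Rightarrow> bool" where
  "linear_map H K T \<longleftrightarrow>
     (\<forall>x\<in>pts H. T x \<in> pts K) \<and>
     (\<forall>x\<in>pts H. \<forall>y\<in>pts H. T (vadd H x y) = vadd K (T x) (T y)) \<and>
     (\<forall>a. \<forall>x\<in>pts H. T (vscale H a x) = vscale K a (T x))"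

definition bounded_operator :: "'a cspace \<Rightarrow> ('a \<Rightarrow> 'a) \<Rightarrow> bool" where
  "bounded_operator H T \<longleftrightarrow>
     linear_map H H T \<and> (\<exists>C. \<forall>x\<in>pts H. vnorm H (T x) \<le> C * vnorm H x)"

definition operator_norm :: "'a cspace \<Rightarrow> ('a \<Rightarrow> 'a) \<Rightarrow> real" where
  "operator_norm H T = Sup {vnorm H (T x) | x. x \<in> pts H \<and> vnorm H x \<le> 1}"

definition adjoint_of :: "'a cspace \<Rightarrow> ('a \<Rightarrow> 'a) \<Rightarrow> ('a \<Rightarrow> 'a) \<Rightarrow> bool" where
  "adjoint_of H T S \<longleftrightarrow>
     bounded_operator H S \<and> (\<forall>x\<in>pts H. \<forall>y\<in>pts H. vip H (T x) y = vip H x (S y))"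

definition operators_commute :: "'a cspace \<Rightarrow> ('a \<Rightarrow> 'a) \<Rightarrow> ('a \<Rightarrow> 'a) \<Rightarrow> bool" where
  "operators_commute H S T \<longleftrightarrow> (\<forall>x\<in>pts H. S (T x) = T (S x))"

definition normal_operator :: "'a cspace \<Rightarrow> ('a \<Rightarrow> 'a) \<Rightarrow> bool" where
  "normal_operator H N \<longleftrightarrow>
     bounded_operator H N \<and> (\<exists>S. adjoint_of H N S \<and> operators_commute H N S)"

definition isometric_embedding :: "'a cspace \<Rightarrow> 'b cspace \<Rightarrow> ('a \<Rightarrow> 'b) \<Rightarrow> bool" where
  "isometric_embedding H K V \<longleftrightarrow>
     linear_map H K V \<and> (\<forall>x\<in>pts H. \<forall>y\<in>pts H. vip K (V x) (V y) = vip H x y)"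

text \<open>The Hilbert space \<open>H\<close> is identified with the closed subspace \<open>V ` pts H\<close> of a larger
  Hilbert space \<open>K\<close>; the intertwining relation \<open>V (T x) = N (V x)\<close> says that this subspace is
  invariant under \<open>N\<close> and that \<open>N\<close> restricts to \<open>T\<close> on it. The type argument is the type of the
  points of \<open>K\<close>, since a formula cannot quantify over types. A subnormal operator (or pair) on a
  separable space has a separable normal extension, so every type with at least continuum many
  elements gives the same notion for the shifts below.\<close>

definition subnormal :: "'b itself \<Rightarrow> 'a cspace \<Rightarrow> ('a \<Rightarrow> 'a) \<Rightarrow> bool" where
  "subnormal _ H T \<longleftrightarrow>
     bounded_operator H T \<and>
     (\<exists>(K :: 'b cspace) V N.
        complex_hilbert_space K \<and> isometric_embedding H K V \<and> normal_operator K N \<and>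
        (\<forall>x\<in>pts H. V (T x) = N (V x)))"

definition jointly_subnormal ::
    "'b itself \<Rightarrow> 'a cspace \<Rightarrow> ('a \<Rightarrow> 'a) \<Rightarrow> ('a \<Rightarrow> 'a) \<Rightarrow> bool" where
  "jointly_subnormal _ H T\<^sub>1 T\<^sub>2 \<longleftrightarrow>
     bounded_operator H T\<^sub>1 \<and> bounded_operator H T\<^sub>2 \<and> operators_commute H T\<^sub>1 T\<^sub>2 \<and>
     (\<exists>(K :: 'b cspace) V N\<^sub>1 N\<^sub>2.
        complex_hilbert_space K \<and> isometric_embedding H K V \<and>
        normal_operator K N\<^sub>1 \<and> normal_operator K N\<^sub>2 \<and> operators_commute K N\<^sub>1 N\<^sub>2 \<and>
        (\<forall>x\<in>pts H. V (T\<^sub>1 x) = N\<^sub>1 (V x) \<and> V (T\<^sub>2 x) = N\<^sub>2 (V x)))"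

definition ell2 :: "('i \<Rightarrow> complex) cspace" where
  "ell2 = \<lparr> pts = {x. (\<lambda>i. (cmod (x i))\<^sup>2) summable_on UNIV},
            vzero = (\<lambda>i. 0),
            vadd = (\<lambda>x y i. x i + y i),
            vscale = (\<lambda>a x i. a * x i),
            vip = (\<lambda>x y. \<Sum>\<^sub>\<infinity>i. x i * cnj (y i)) \<rparr>"

section \<open>Unilateral weighted shifts\<close>

definition weight_sequence :: "(nat \<Rightarrow> real) \<Rightarrow> bool" where
  "weight_sequence \<omega> \<longleftrightarrow> (\<forall>n. 0 < \<omega> n) \<and> bounded (range \<omega>)"

text \<open>In coordinates: the unit vector at \<open>n\<close> is sent to \<open>\<omega> n\<close> times the unit vector at \<open>n + 1\<close>.\<close>

definition weighted_shift :: "(nat \<Rightarrow> real) \<Rightarrow> (nat \<Rightarrow> complex) \<Rightarrow> (nat \<Rightarrow> complex)" where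
  "weighted_shift \<omega> x n = (case n of 0 \<Rightarrow> 0 | Suc m \<Rightarrow> complex_of_real (\<omega> m) * x m)"

definition moment :: "(nat \<Rightarrow> real) \<Rightarrow> nat \<Rightarrow> real" where
  "moment \<omega> k = (\<Prod>i<k. (\<omega> i)\<^sup>2)"

text \<open>A measure on a compact set is a Borel measure on the whole space that gives mass zero to the
  complement.\<close>

definition berger_measure :: "(nat \<Rightarrow> real) \<Rightarrow> real measure \<Rightarrow> bool" where
  "berger_measure \<omega> \<sigma> \<longleftrightarrow>
     prob_space \<sigma> \<and> sets \<sigma> = sets borel \<and>
     emeasure \<sigma> (- {0..(operator_norm ell2 (weighted_shift \<omega>))\<^sup>2}) = 0 \<and>
     (\<forall>k. moment \<omega> k = (\<integral>r. r ^ k \<partial>\<sigma>))"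

section \<open>2-variable weighted shifts\<close>

definition weight_families :: "(nat \<times> nat \<Rightarrow> real) \<Rightarrow> (nat \<times> nat \<Rightarrow> real) \<Rightarrow> bool" where
  "weight_families \<alpha> \<beta> \<longleftrightarrow>
     (\<forall>k. 0 < \<alpha> k) \<and> (\<forall>k. 0 < \<beta> k) \<and> bounded (range \<alpha>) \<and> bounded (range \<beta>) \<and>
     (\<forall>i j. \<beta> (i + 1, j) * \<alpha> (i, j) = \<alpha> (i, j + 1) * \<beta> (i, j))"

definition shift1 :: "(nat \<times> nat \<Rightarrow> real) \<Rightarrow> (nat \<times> nat \<Rightarrow> complex) \<Rightarrow> (nat \<times> nat \<Rightarrow> complex)" where
  "shift1 \<alpha> x = (\<lambda>(i, j). case i of 0 \<Rightarrow> 0 | Suc m \<Rightarrow> complex_of_real (\<alpha> (m, j)) * x (m, j))"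

definition shift2 :: "(nat \<times> nat \<Rightarrow> real) \<Rightarrow> (nat \<times> nat \<Rightarrow> complex) \<Rightarrow> (nat \<times> nat \<Rightarrow> complex)" where
  "shift2 \<beta> x = (\<lambda>(i, j). case j of 0 \<Rightarrow> 0 | Suc m \<Rightarrow> complex_of_real (\<beta> (i, m)) * x (i, m))"

text \<open>The product of the squared weights along the path that first goes right and then up; by the
  commutation relation in \<^const>\<open>weight_families\<close> every nondecreasing path gives the same
  value.\<close>

definition moment2 :: "(nat \<times> nat \<Rightarrow> real) \<Rightarrow> (nat \<times> nat \<Rightarrow> real) \<Rightarrow> nat \<Rightarrow> nat \<Rightarrow> real" where
  "moment2 \<alpha> \<beta> k\<^sub>1 k\<^sub>2 = (\<Prod>i<k\<^sub>1. (\<alpha> (i, 0))\<^sup>2) * (\<Prod>j<k\<^sub>2. (\<beta> (k\<^sub>1, j))\<^sup>2)"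

definition berger_measure2 ::
    "(nat \<times> nat \<Rightarrow> real) \<Rightarrow> (nat \<times> nat \<Rightarrow> real) \<Rightarrow> (real \<times> real) measure \<Rightarrow> bool" where
  "berger_measure2 \<alpha> \<beta> \<mu> \<longleftrightarrow>
     prob_space \<mu> \<and> sets \<mu> = sets borel \<and>
     emeasure \<mu> (- ({0..(operator_norm ell2 (shift1 \<alpha>))\<^sup>2} \<times>
                    {0..(operator_norm ell2 (shift2 \<beta>))\<^sup>2})) = 0 \<and>
     (\<forall>k\<^sub>1 k\<^sub>2. moment2 \<alpha> \<beta> k\<^sub>1 k\<^sub>2 = (\<integral>(s, t). s ^ k\<^sub>1 * t ^ k\<^sub>2 \<partial>\<mu>))"

section \<open>Polynomial embeddings\<close>

definition measure_support :: "real measure \<Rightarrow> real set" where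
  "measure_support \<sigma> = {x. \<forall>U. open U \<longrightarrow> x \<in> U \<longrightarrow> emeasure \<sigma> U > 0}"

text \<open>The weights \<open>\<alpha>\<close>, \<open>\<beta>\<close> are those of a 2-variable weighted shift with the prescribed moments.
  They are determined by the moments; they need not exist for every choice of \<open>p\<close> and \<open>q\<close> (the
  moments must be positive).\<close>

definition pq_embedding ::
    "real set \<Rightarrow> real poly \<Rightarrow> real poly \<Rightarrow> real measure \<Rightarrow>
     (nat \<times> nat \<Rightarrow> real) \<Rightarrow> (nat \<times> nat \<Rightarrow> real) \<Rightarrow> bool" where
  "pq_embedding I p q \<sigma> \<alpha> \<beta> \<longleftrightarrow>
     is_interval I \<and> closed I \<and> I \<subseteq> {0..} \<and>
     (\<forall>r\<in>I. 0 \<le> poly p r \<and> 0 \<le> poly q r) \<and> inj_on (\<lambda>r. (poly p r, poly q r)) I \<and>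
     measure_support \<sigma> \<subseteq> I \<and>
     weight_families \<alpha> \<beta> \<and>
     (\<forall>k\<^sub>1 k\<^sub>2. moment2 \<alpha> \<beta> k\<^sub>1 k\<^sub>2 = (LINT r:I|\<sigma>. poly p r ^ k\<^sub>1 * poly q r ^ k\<^sub>2))"

end

theory Submission
  imports Defs
begin

text \<open>
  \<^bold>\<open>Why the theorem is true.\<close> The measure \<open>\<mu> = \<sigma> \<circ> f\<^sup>-\<^sup>1\<close> has the right moments by the
  change-of-variables formula, so two things remain: a commuting normal extension, and the location
  of the mass of \<open>\<mu>\<close>.

  The idea for the extension: if a pair of shifts has a Berger measure \<open>\<mu>\<close>, then the unit vector at
  \<open>(i, j)\<close> may be represented by the function
  \<open>e^(\<i> (i\<theta> + j\<phi>)) \<surd>(s^i t^j / \<gamma>\<^sub>i\<^sub>j)\<close> on the product of the torus with the space that carries \<open>\<mu>\<close>.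
  These functions are orthonormal, and the shifts become
  multiplication by \<open>e^(\<i>\<theta>) \<surd>s\<close> and \<open>e^(\<i>\<phi>) \<surd>t\<close>, which are commuting normal operators on the
  whole \<open>L\<^sup>2\<close> space. Pulling back along \<open>f\<close> puts \<open>s = p(r)\<close>, \<open>t = q(r)\<close> and replaces \<open>\<mu>\<close> by \<open>\<sigma>\<close>;
  expanding in Fourier series over the torus replaces multiplication by \<open>e^(\<i>\<theta>)\<close> by a translation
  of the lattice \<open>\<int>\<^sup>2\<close>. The extension space used below is therefore \<open>L\<^sup>2\<close> of \<open>\<int>\<^sup>2 \<times> \<real>\<close> with the product
  of counting measure and \<open>\<sigma>\<close>, and the normal operators are
  \<open>(N\<^sub>1 g)(m, n, r) = \<surd>p(r) g(m - 1, n, r)\<close> and \<open>(N\<^sub>2 g)(m, n, r) = \<surd>q(r) g(m, n - 1, r)\<close>, with adjoints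
  that translate the other way. The isometry sends \<open>x\<close> to the function
  \<open>x\<^sub>i\<^sub>j \<surd>(p(r)^i q(r)^j / \<gamma>\<^sub>i\<^sub>j)\<close> on the nonnegative quadrant, extended by zero
  (\<open>isometric_embedding_spread\<close>, \<open>jointly_subnormal_shifts\<close>).

  The points of the extension space have to be sequences of complex numbers rather than
  classes of functions. A class is determined by countably many of its integrals, namely those over
  the sets \<open>{k} \<times> {c<..}\<close> with \<open>c\<close> rational (\<open>coded_L2_fibered\<close>), so the class is
  replaced by the sequence of these integrals. This passage is linear, and the inner product is
  computed by choosing any function with the given integrals. Completeness of the resulting space is
  the Riesz--Fischer theorem (\<open>Riesz_Fischer\<close>, \<open>complex_hilbert_space_L2\<close>).

  For the location of the mass, note that \<open>\<sigma>\<close>-almost every \<open>r\<close> lies in a compact set on which \<open>p\<close> and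
  \<open>q\<close> are nonnegative, and
  \<open>\<integral> p^k d\<sigma> = \<gamma>\<^sub>k\<^sub>0 \<le> \<parallel>T\<^sub>1\<parallel>^(2k)\<close> for all \<open>k\<close> because every weight is at most the operator norm.
  Markov's inequality then forces \<open>p \<le> \<parallel>T\<^sub>1\<parallel>\<^sup>2\<close> almost everywhere (\<open>AE_le_of_moment_bounds\<close>), and
  likewise for \<open>q\<close>.
\<close>

section \<open>Square-integrable functions and the Riesz--Fischer theorem\<close>

definition square_integrable :: "'a measure \<Rightarrow> ('a \<Rightarrow> complex) set" where
  "square_integrable M = {g \<in> borel_measurable M. integrable M (\<lambda>x. (cmod (g x))\<^sup>2)}"

definition L2_norm :: "'a measure \<Rightarrow> ('a \<Rightarrow> complex) \<Rightarrow> real" where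
  "L2_norm M g = sqrt (\<integral>x. (cmod (g x))\<^sup>2 \<partial>M)"

lemma square_integrableI_bound:
  assumes [measurable]: "g \<in> borel_measurable M" and "integrable M h"
    and "\<And>x. (cmod (g x))\<^sup>2 \<le> h x"
  shows "g \<in> square_integrable M"
proof -
  have "integrable M (\<lambda>x. (cmod (g x))\<^sup>2)"
    by (rule Bochner_Integration.integrable_bound[OF assms(2)])
       (use assms(3) in \<open>auto intro!: AE_I2 order_trans[OF assms(3)]\<close>)
  then show ?thesis by (simp add: square_integrable_def)
qed

lemma square_integrable_measurable:
  "g \<in> square_integrable M \<Longrightarrow> g \<in> borel_measurable M"
  by (simp add: square_integrable_def)

lemma square_integrable_norm:
  "g \<in> square_integrable M \<Longrightarrow> integrable M (\<lambda>x. (cmod (g x))\<^sup>2)"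
  by (simp add: square_integrable_def)

lemma norm_add_square_le: "(cmod (a + b))\<^sup>2 \<le> 2 * (cmod a)\<^sup>2 + 2 * (cmod b)\<^sup>2"
proof -
  have "(cmod (a + b))\<^sup>2 \<le> (cmod a + cmod b)\<^sup>2"
    by (simp add: norm_triangle_ineq power_mono)
  also have "\<dots> \<le> 2 * (cmod a)\<^sup>2 + 2 * (cmod b)\<^sup>2"
    using sum_squares_bound[of "cmod a" "cmod b"] by (simp add: power2_sum)
  finally show ?thesis .
qed

lemma square_integrable_zero: "(\<lambda>x. 0) \<in> square_integrable M"
  by (simp add: square_integrable_def)

lemma square_integrable_add:
  assumes "f \<in> square_integrable M" "g \<in> square_integrable M"
  shows "(\<lambda>x. f x + g x) \<in> square_integrable M"
proof (rule square_integrableI_bound)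
  show "(\<lambda>x. f x + g x) \<in> borel_measurable M"
    using assms[THEN square_integrable_measurable] by measurable
  show "integrable M (\<lambda>x. 2 * (cmod (f x))\<^sup>2 + 2 * (cmod (g x))\<^sup>2)"
    using assms[THEN square_integrable_norm] by simp
qed (rule norm_add_square_le)

lemma square_integrable_scale:
  assumes "f \<in> square_integrable M"
  shows "(\<lambda>x. a * f x) \<in> square_integrable M"
  using assms by (auto simp: square_integrable_def norm_mult power_mult_distrib)

lemma square_integrable_diff:
  assumes "f \<in> square_integrable M" "g \<in> square_integrable M"
  shows "(\<lambda>x. f x - g x) \<in> square_integrable M"
  using square_integrable_add[OF assms(1) square_integrable_scale[OF assms(2), of "-1"]] by simp

lemma square_integrable_indicator:
  assumes "A \<in> sets M" "emeasure M A < \<infinity>"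
  shows "(\<lambda>x. of_real (indicator A x)) \<in> square_integrable M"
proof -
  have "(\<lambda>x. (cmod (complex_of_real (indicator A x)))\<^sup>2) = indicator A"
    by (auto simp: indicator_def)
  then show ?thesis using assms by (simp add: square_integrable_def)
qed

lemma integrable_norm_mult:
  assumes "f \<in> square_integrable M" "g \<in> square_integrable M"
  shows "integrable M (\<lambda>x. cmod (f x) * cmod (g x))"
proof (rule Bochner_Integration.integrable_bound)
  show "integrable M (\<lambda>x. (cmod (f x))\<^sup>2 + (cmod (g x))\<^sup>2)"
    using assms[THEN square_integrable_norm] by simp
  show "(\<lambda>x. cmod (f x) * cmod (g x)) \<in> borel_measurable M"
    using assms[THEN square_integrable_measurable] by measurable
  have "cmod a * cmod b \<le> (cmod a)\<^sup>2 + (cmod b)\<^sup>2" for a b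
  proof -
    have "0 \<le> cmod a * cmod b" by simp
    then show ?thesis using sum_squares_bound[of "cmod a" "cmod b"] by linarith
  qed
  then show "AE x in M. norm (cmod (f x) * cmod (g x)) \<le> norm ((cmod (f x))\<^sup>2 + (cmod (g x))\<^sup>2)"
    by (auto intro!: AE_I2)
qed

lemma borel_measurable_cnj [measurable]: "cnj \<in> borel_measurable borel"
  by (intro borel_measurable_continuous_onI continuous_intros)

lemma integrable_mult_cnj:
  assumes "f \<in> square_integrable M" "g \<in> square_integrable M"
  shows "integrable M (\<lambda>x. f x * cnj (g x))"
proof (rule Bochner_Integration.integrable_bound[OF integrable_norm_mult[OF assms]])
  note [measurable] = assms[THEN square_integrable_measurable]
  show "(\<lambda>x. f x * cnj (g x)) \<in> borel_measurable M"
    by measurable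
qed (simp add: norm_mult)

lemma L2_norm_nonneg: "0 \<le> L2_norm M g"
  by (simp add: L2_norm_def)

lemma L2_norm_square: "(L2_norm M g)\<^sup>2 = (\<integral>x. (cmod (g x))\<^sup>2 \<partial>M)"
  by (simp add: L2_norm_def)

lemma L2_norm_eq_0_iff:
  assumes "g \<in> square_integrable M"
  shows "L2_norm M g = 0 \<longleftrightarrow> (AE x in M. g x = 0)"
  using integral_nonneg_eq_0_iff_AE[OF square_integrable_norm[OF assms]]
  by (simp add: L2_norm_def)

lemma Cauchy_Schwarz_integral:
  assumes "f \<in> square_integrable M" "g \<in> square_integrable M"
  shows "(\<integral>x. cmod (f x) * cmod (g x) \<partial>M) \<le> L2_norm M f * L2_norm M g"
proof -
  note [measurable] = assms[THEN square_integrable_measurable]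
  let ?X = "\<integral>x. cmod (f x) * cmod (g x) \<partial>M"
  have X: "(\<integral>\<^sup>+x. ennreal (cmod (f x)) * ennreal (cmod (g x)) \<partial>M) = ennreal ?X"
    using nn_integral_eq_integral[OF integrable_norm_mult[OF assms]]
    by (simp add: ennreal_mult)
  have N: "(\<integral>\<^sup>+x. (ennreal (cmod (h x)))\<^sup>2 \<partial>M) = ennreal ((L2_norm M h)\<^sup>2)"
    if "h \<in> square_integrable M" for h
    using nn_integral_eq_integral[OF square_integrable_norm[OF that]]
    by (simp add: L2_norm_square ennreal_power)
  have "(ennreal ?X)\<^sup>2 \<le> ennreal ((L2_norm M f)\<^sup>2) * ennreal ((L2_norm M g)\<^sup>2)"
    using Cauchy_Schwarz_nn_integral[of "\<lambda>x. ennreal (cmod (f x))" M "\<lambda>x. ennreal (cmod (g x))"]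
    by (simp add: X N assms)
  then have "ennreal (?X\<^sup>2) \<le> ennreal ((L2_norm M f * L2_norm M g)\<^sup>2)"
    by (simp add: ennreal_power ennreal_mult power_mult_distrib)
  then have "?X\<^sup>2 \<le> (L2_norm M f * L2_norm M g)\<^sup>2"
    by (simp add: ennreal_le_iff)
  then show ?thesis
    by (rule power2_le_imp_le) (simp add: L2_norm_nonneg)
qed

lemma L2_norm_triangle:
  assumes "f \<in> square_integrable M" "g \<in> square_integrable M"
  shows "L2_norm M (\<lambda>x. f x + g x) \<le> L2_norm M f + L2_norm M g"
proof -
  note int = assms[THEN square_integrable_norm] integrable_norm_mult[OF assms]
  have "(L2_norm M (\<lambda>x. f x + g x))\<^sup>2 \<le>
    (\<integral>x. (cmod (f x))\<^sup>2 + (cmod (g x))\<^sup>2 + 2 * (cmod (f x) * cmod (g x)) \<partial>M)"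
    unfolding L2_norm_square
  proof (rule integral_mono)
    show "integrable M (\<lambda>x. (cmod (f x + g x))\<^sup>2)"
      by (rule square_integrable_norm[OF square_integrable_add[OF assms]])
    show "integrable M (\<lambda>x. (cmod (f x))\<^sup>2 + (cmod (g x))\<^sup>2 + 2 * (cmod (f x) * cmod (g x)))"
      by (intro Bochner_Integration.integrable_add integrable_mult_right int)
    show "(cmod (f x + g x))\<^sup>2 \<le> (cmod (f x))\<^sup>2 + (cmod (g x))\<^sup>2 + 2 * (cmod (f x) * cmod (g x))" for x
      using power_mono[OF norm_triangle_ineq[of "f x" "g x"], of 2] by (simp add: power2_sum)
  qed
  also have "\<dots> = (L2_norm M f)\<^sup>2 + (L2_norm M g)\<^sup>2 + 2 * (\<integral>x. cmod (f x) * cmod (g x) \<partial>M)"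
    by (simp only: L2_norm_square Bochner_Integration.integral_add integral_mult_right_zero
        Bochner_Integration.integrable_add integrable_mult_right int)
  also have "\<dots> \<le> (L2_norm M f + L2_norm M g)\<^sup>2"
    using Cauchy_Schwarz_integral[OF assms] by (simp add: power2_sum)
  finally show ?thesis
    by (rule power2_le_imp_le) (simp add: L2_norm_nonneg)
qed

text \<open>The increments \<open>d\<^sub>j\<close> have \<open>\<integral> \<bar>d\<^sub>j\<bar>\<^sup>2 \<le> 4^(-j)\<close>, so \<open>\<Sum>\<^sub>j 2^j \<bar>d\<^sub>j\<bar>\<^sup>2\<close> has a finite integral and is finite
  almost everywhere. At such a point \<open>\<bar>d\<^sub>j\<bar>\<close> is dominated by a multiple of \<open>2^(-j/2)\<close>, so the increments are
  summable. The weight \<open>2^j\<close> replaces the triangle inequality for infinite sums.\<close>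

lemma AE_convergent_of_rapidly_Cauchy:
  fixes u :: "nat \<Rightarrow> 'a \<Rightarrow> complex"
  assumes u: "\<And>j. u j \<in> square_integrable M"
    and rapid: "\<And>j. L2_norm M (\<lambda>x. u (Suc j) x - u j x) \<le> (1/2) ^ j"
  shows "AE x in M. convergent (\<lambda>j. u j x)"
proof -
  have [measurable]: "u j \<in> borel_measurable M" for j
    by (rule square_integrable_measurable[OF u])
  define w where "w j x = ennreal (2 ^ j * (cmod (u (Suc j) x - u j x))\<^sup>2)" for j x
  have [measurable]: "w j \<in> borel_measurable M" for j
    unfolding w_def by measurable
  have w_int: "(\<integral>\<^sup>+x. w j x \<partial>M) \<le> ennreal ((1/2) ^ j)" for j
  proof -
    have sq: "integrable M (\<lambda>x. (cmod (u (Suc j) x - u j x))\<^sup>2)"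
      by (rule square_integrable_norm[OF square_integrable_diff[OF u u]])
    have "(\<integral>\<^sup>+x. w j x \<partial>M) = ennreal (2 ^ j * (L2_norm M (\<lambda>x. u (Suc j) x - u j x))\<^sup>2)"
      unfolding w_def L2_norm_square using sq by (subst nn_integral_eq_integral) auto
    also have "\<dots> \<le> ennreal (2 ^ j * ((1/2) ^ j)\<^sup>2)"
      by (intro ennreal_leI mult_left_mono power_mono rapid L2_norm_nonneg) auto
    also have "(2::real) ^ j * ((1/2) ^ j)\<^sup>2 = (1/2) ^ j"
      by (simp add: power2_eq_square field_simps flip: power_mult_distrib)
    finally show ?thesis .
  qed
  have "(\<integral>\<^sup>+x. (\<Sum>j. w j x) \<partial>M) = (\<Sum>j. \<integral>\<^sup>+x. w j x \<partial>M)"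
    by (rule nn_integral_suminf) measurable
  also have "\<dots> \<le> (\<Sum>j. ennreal ((1/2) ^ j))"
    by (intro suminf_le w_int) auto
  also have "\<dots> = ennreal (\<Sum>j. (1/2) ^ j)"
    by (rule suminf_ennreal2) (auto intro: summable_geometric)
  also have "\<dots> < \<infinity>" by simp
  finally have "AE x in M. (\<Sum>j. w j x) \<noteq> \<infinity>"
    by (intro nn_integral_PInf_AE) auto
  then show ?thesis
  proof eventually_elim
    case (elim x)
    let ?S = "enn2real (\<Sum>j. w j x)"
    have "2 ^ j * (cmod (u (Suc j) x - u j x))\<^sup>2 \<le> ?S" for j
    proof -
      have "w j x \<le> (\<Sum>j. w j x)"
        using sum_le_suminf[of "\<lambda>j. w j x" "{j}"] by simp
      then have "enn2real (w j x) \<le> ?S"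
        using elim by (intro enn2real_mono) (auto simp: top.not_eq_extremum)
      then show ?thesis by (simp add: w_def)
    qed
    then have "(cmod (u (Suc j) x - u j x))\<^sup>2 \<le> (1/2) ^ j * ?S" for j
      by (simp add: field_simps power_one_over)
    then have "cmod (u (Suc j) x - u j x) \<le> sqrt ((1/2) ^ j * ?S)" for j
      by (simp add: real_le_rsqrt)
    then have bd: "norm (u (Suc j) x - u j x) \<le> (sqrt (1/2)) ^ j * sqrt ?S" for j
      by (simp only: real_sqrt_mult real_sqrt_power)
    have "summable (\<lambda>j. (sqrt (1/2)) ^ j * sqrt ?S)"
      by (intro summable_mult2 summable_geometric) simp
    then have "summable (\<lambda>j. u (Suc j) x - u j x)"
      by (rule summable_comparison_test') (rule bd)
    then have "convergent (\<lambda>j. \<Sum>i<j. u (Suc i) x - u i x)"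
      by (simp add: summable_iff_convergent)
    then have "convergent (\<lambda>j. u j x - u 0 x)"
      by (simp only: sum_lessThan_telescope[of "\<lambda>j. u j x"])
    then show "convergent (\<lambda>j. u j x)"
      using convergent_diff_const_right_iff by blast
  qed
qed

text \<open>A rapidly Cauchy subsequence converges almost everywhere; Fatou's lemma, applied along it to
  \<open>g n - g (s j)\<close>, bounds the distance of \<open>g n\<close> to the limit by the Cauchy bound.\<close>

lemma Riesz_Fischer:
  fixes g :: "nat \<Rightarrow> 'a \<Rightarrow> complex"
  assumes g: "\<And>n. g n \<in> square_integrable M"
    and Cauchy: "\<And>\<epsilon>. \<epsilon> > 0 \<Longrightarrow> \<exists>N. \<forall>m\<ge>N. \<forall>n\<ge>N. L2_norm M (\<lambda>x. g m x - g n x) < \<epsilon>"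
  shows "\<exists>h\<in>square_integrable M. \<forall>\<epsilon>>0. \<exists>N. \<forall>n\<ge>N. L2_norm M (\<lambda>x. g n x - h x) < \<epsilon>"
proof -
  have [measurable]: "g n \<in> borel_measurable M" for n
    by (rule square_integrable_measurable[OF g])
  have "\<exists>N. \<forall>m\<ge>N. \<forall>n\<ge>N. L2_norm M (\<lambda>x. g m x - g n x) < (1/2) ^ j" for j :: nat
    by (rule Cauchy) simp
  then obtain N where N: "\<And>j m n. m \<ge> N j \<Longrightarrow> n \<ge> N j \<Longrightarrow> L2_norm M (\<lambda>x. g m x - g n x) < (1/2) ^ j"
    by metis
  \<comment> \<open>An index that lies beyond \<open>N i\<close> for every \<open>i \<le> j\<close> and beyond \<open>j\<close> itself.\<close>
  define s where "s j = j + (\<Sum>i\<le>j. N i)" for j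
  have sN: "N j \<le> s j" "N j \<le> s (Suc j)" "j \<le> s j" for j
  proof -
    have "N j \<le> (\<Sum>i\<le>j. N i)" by (rule member_le_sum) auto
    then show "N j \<le> s j" "N j \<le> s (Suc j)" "j \<le> s j" by (auto simp: s_def)
  qed
  define h where "h x = lim (\<lambda>j. g (s j) x)" for x
  have [measurable]: "h \<in> borel_measurable M" unfolding h_def by measurable
  have "AE x in M. convergent (\<lambda>j. g (s j) x)"
    by (rule AE_convergent_of_rapidly_Cauchy) (auto intro!: g less_imp_le N sN)
  then have lim: "AE x in M. (\<lambda>j. g (s j) x) \<longlonglongrightarrow> h x"
    by eventually_elim (simp add: h_def convergent_LIMSEQ_iff)
  \<comment> \<open>Integrability of the difference is not yet known here, hence the extended integral.\<close>
  have tail: "(\<integral>\<^sup>+x. ennreal ((cmod (g n x - h x))\<^sup>2) \<partial>M) \<le> ennreal (\<epsilon>\<^sup>2)"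
    if "\<epsilon> > 0" and K: "\<forall>m\<ge>K. L2_norm M (\<lambda>x. g n x - g m x) \<le> \<epsilon>" for n K \<epsilon>
  proof -
    have "(\<integral>\<^sup>+x. ennreal ((cmod (g n x - h x))\<^sup>2) \<partial>M)
      = (\<integral>\<^sup>+x. liminf (\<lambda>j. ennreal ((cmod (g n x - g (s j) x))\<^sup>2)) \<partial>M)"
    proof (rule nn_integral_cong_AE, use lim in eventually_elim)
      case (elim x)
      then have "(\<lambda>j. ennreal ((cmod (g n x - g (s j) x))\<^sup>2)) \<longlonglongrightarrow> ennreal ((cmod (g n x - h x))\<^sup>2)"
        by (intro tendsto_intros)
      from lim_imp_Liminf[OF trivial_limit_sequentially this] show ?case by (rule sym)
    qed
    also have "\<dots> \<le> liminf (\<lambda>j. \<integral>\<^sup>+x. ennreal ((cmod (g n x - g (s j) x))\<^sup>2) \<partial>M)"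
      by (rule nn_integral_liminf) measurable
    also have "\<dots> = liminf (\<lambda>j. ennreal ((L2_norm M (\<lambda>x. g n x - g (s j) x))\<^sup>2))"
      unfolding L2_norm_square
      by (subst nn_integral_eq_integral) (auto intro!: square_integrable_norm square_integrable_diff g)
    also have "\<dots> \<le> ennreal (\<epsilon>\<^sup>2)"
    proof (rule Liminf_le)
      show "\<forall>\<^sub>F j in sequentially. ennreal ((L2_norm M (\<lambda>x. g n x - g (s j) x))\<^sup>2) \<le> ennreal (\<epsilon>\<^sup>2)"
        using eventually_ge_at_top[of K]
      proof eventually_elim
        case (elim j)
        then have "L2_norm M (\<lambda>x. g n x - g (s j) x) \<le> \<epsilon>"
          using K sN(3)[of j] by auto
        then show ?case by (intro ennreal_leI power_mono L2_norm_nonneg)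
      qed
    qed simp
    finally show ?thesis .
  qed
  have tail_L2: "(\<lambda>x. g n x - h x) \<in> square_integrable M \<and> L2_norm M (\<lambda>x. g n x - h x) \<le> \<epsilon>"
    if "\<epsilon> > 0" "\<forall>m\<ge>K. L2_norm M (\<lambda>x. g n x - g m x) \<le> \<epsilon>" for n K \<epsilon>
  proof -
    have fin: "integrable M (\<lambda>x. (cmod (g n x - h x))\<^sup>2)"
      by (rule integrableI_bounded) (use tail[OF that] in \<open>auto simp: less_top[symmetric] top_unique\<close>)
    have "ennreal ((L2_norm M (\<lambda>x. g n x - h x))\<^sup>2) \<le> ennreal (\<epsilon>\<^sup>2)"
      using tail[OF that] nn_integral_eq_integral[OF fin] by (simp add: L2_norm_square)
    then have "(L2_norm M (\<lambda>x. g n x - h x))\<^sup>2 \<le> \<epsilon>\<^sup>2"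
      by (simp add: ennreal_le_iff)
    then show ?thesis
      using fin \<open>\<epsilon> > 0\<close> by (auto simp: square_integrable_def intro: power2_le_imp_le)
  qed
  have conv: "\<exists>K. \<forall>n\<ge>K. (\<lambda>x. g n x - h x) \<in> square_integrable M \<and> L2_norm M (\<lambda>x. g n x - h x) < \<epsilon>"
    if "\<epsilon> > 0" for \<epsilon> :: real
  proof -
    from Cauchy[OF half_gt_zero[OF that]]
    obtain K where "\<forall>m\<ge>K. \<forall>n\<ge>K. L2_norm M (\<lambda>x. g m x - g n x) < \<epsilon> / 2"
      by blast
    then have "\<forall>n\<ge>K. (\<lambda>x. g n x - h x) \<in> square_integrable M \<and> L2_norm M (\<lambda>x. g n x - h x) \<le> \<epsilon> / 2"
      using tail_L2[of "\<epsilon> / 2" K] that by (auto simp: less_imp_le)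
    then show ?thesis using that by (intro exI[of _ K]) force
  qed
  obtain n where "(\<lambda>x. g n x - h x) \<in> square_integrable M"
    using conv[of 1] by auto
  from square_integrable_diff[OF g[of n] this] have "h \<in> square_integrable M" by simp
  with conv show ?thesis by blast
qed

section \<open>Hilbert spaces of square-integrable functions, coded as sequences\<close>

text \<open>Operators of the form \<open>g \<mapsto> u \<cdot> (g \<circ> \<tau>)\<close> with \<open>u\<close> bounded and \<open>\<tau>\<close> measure preserving cover the
  bilateral shifts with operator-valued weights that make up the normal extension.\<close>

definition weighted_composition :: "('a \<Rightarrow> real) \<Rightarrow> ('a \<Rightarrow> 'a) \<Rightarrow> ('a \<Rightarrow> complex) \<Rightarrow> 'a \<Rightarrow> complex" where
  "weighted_composition u \<tau> g x = of_real (u x) * g (\<tau> x)"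

text \<open>The bound is pointwise, so that the operator bound follows from a pointwise comparison of
  integrands.\<close>

definition multiplier :: "'a measure \<Rightarrow> ('a \<Rightarrow> real) \<Rightarrow> bool" where
  "multiplier M u \<longleftrightarrow> u \<in> borel_measurable M \<and> (\<exists>C. \<forall>x. \<bar>u x\<bar> \<le> C)"

definition measure_preserving :: "'a measure \<Rightarrow> ('a \<Rightarrow> 'a) \<Rightarrow> bool" where
  "measure_preserving M \<tau> \<longleftrightarrow> \<tau> \<in> measurable M M \<and> distr M M \<tau> = M"

lemma integrable_measure_preserving:
  fixes F :: "'a \<Rightarrow> 'b :: {banach, second_countable_topology}"
  assumes "measure_preserving M \<tau>" "integrable M F"
  shows "integrable M (\<lambda>x. F (\<tau> x))"
  using assms integrable_distr[of \<tau> M M F] by (auto simp: measure_preserving_def)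

lemma integral_measure_preserving:
  fixes F :: "'a \<Rightarrow> 'b :: {banach, second_countable_topology}"
  assumes "measure_preserving M \<tau>" "F \<in> borel_measurable M"
  shows "(\<integral>x. F (\<tau> x) \<partial>M) = (\<integral>x. F x \<partial>M)"
  using assms integral_distr[of \<tau> M M F] by (auto simp: measure_preserving_def)

lemma AE_measure_preserving:
  assumes "measure_preserving M \<tau>" "AE x in M. P x"
  shows "AE x in M. P (\<tau> x)"
proof (rule AE_distrD[where M'=M])
  show "AE x in distr M M \<tau>. P x" using assms by (metis measure_preserving_def)
qed (use assms in \<open>simp add: measure_preserving_def\<close>)

lemma weighted_composition_bound:
  assumes u: "multiplier M u" and \<tau>: "measure_preserving M \<tau>"
  shows "\<exists>C. \<forall>g\<in>square_integrable M. weighted_composition u \<tau> g \<in> square_integrable M \<and>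
    L2_norm M (weighted_composition u \<tau> g) \<le> C * L2_norm M g"
proof -
  from u obtain C where [measurable]: "u \<in> borel_measurable M" and C: "\<And>x. \<bar>u x\<bar> \<le> C"
    by (auto simp: multiplier_def)
  have [measurable]: "\<tau> \<in> measurable M M" using \<tau> by (simp add: measure_preserving_def)
  have "0 \<le> C" using C[of undefined] by simp
  have "weighted_composition u \<tau> g \<in> square_integrable M \<and>
    L2_norm M (weighted_composition u \<tau> g) \<le> C * L2_norm M g"
    if g: "g \<in> square_integrable M" for g
  proof
    note [measurable] = g[THEN square_integrable_measurable]
    have [measurable]: "weighted_composition u \<tau> g \<in> borel_measurable M"
      unfolding weighted_composition_def[abs_def] by measurable
    have int: "integrable M (\<lambda>x. C\<^sup>2 * (cmod (g (\<tau> x)))\<^sup>2)"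
      using integrable_measure_preserving[OF \<tau> square_integrable_norm[OF g]] by simp
    have le: "(cmod (weighted_composition u \<tau> g x))\<^sup>2 \<le> C\<^sup>2 * (cmod (g (\<tau> x)))\<^sup>2" for x
      using C[of x] \<open>0 \<le> C\<close>
      by (auto simp: weighted_composition_def norm_mult power_mult_distrib intro!: mult_right_mono abs_le_square_iff[THEN iffD1])
    show sq: "weighted_composition u \<tau> g \<in> square_integrable M"
      by (rule square_integrableI_bound[OF _ int le]) simp
    have "(L2_norm M (weighted_composition u \<tau> g))\<^sup>2 \<le> (\<integral>x. C\<^sup>2 * (cmod (g (\<tau> x)))\<^sup>2 \<partial>M)"
      unfolding L2_norm_square by (rule integral_mono[OF square_integrable_norm[OF sq] int le])
    also have "\<dots> = (C * L2_norm M g)\<^sup>2"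
      using integral_measure_preserving[OF \<tau>, of "\<lambda>x. (cmod (g x))\<^sup>2"]
      by (simp add: power_mult_distrib L2_norm_square)
    finally show "L2_norm M (weighted_composition u \<tau> g) \<le> C * L2_norm M g"
      by (rule power2_le_imp_le) (simp add: L2_norm_nonneg \<open>0 \<le> C\<close>)
  qed
  then show ?thesis by blast
qed

text \<open>The test sets \<open>T n\<close> separate the classes of square-integrable functions, so that a class may be
  identified with its sequence of integrals over these sets.\<close>

locale coded_L2 =
  fixes M :: "'a measure" and T :: "nat \<Rightarrow> 'a set"
  assumes T_sets: "T n \<in> sets M"
    and T_finite: "emeasure M (T n) < \<infinity>"
    and T_total: "\<lbrakk>g \<in> square_integrable M; \<And>n. (LINT x:T n|M. g x) = 0\<rbrakk> \<Longrightarrow> AE x in M. g x = 0"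
begin

definition code :: "('a \<Rightarrow> complex) \<Rightarrow> nat \<Rightarrow> complex" where
  "code g = (\<lambda>n. LINT x:T n|M. g x)"

text \<open>A representative of the class with the given code, arbitrary when there is none. All
  uses pass through \<open>decode_code\<close>: the representative agrees almost everywhere with any other.\<close>

definition decode :: "(nat \<Rightarrow> complex) \<Rightarrow> 'a \<Rightarrow> complex" where
  "decode c = (SOME g. g \<in> square_integrable M \<and> code g = c)"

definition L2_space :: "(nat \<Rightarrow> complex) cspace" where
  "L2_space = \<lparr> pts = code ` square_integrable M,
     vzero = (\<lambda>n. 0),
     vadd = (\<lambda>c d n. c n + d n),
     vscale = (\<lambda>a c n. a * c n),
     vip = (\<lambda>c d. \<integral>x. decode c x * cnj (decode d x) \<partial>M) \<rparr>"

definition lift_operator :: "(('a \<Rightarrow> complex) \<Rightarrow> ('a \<Rightarrow> complex)) \<Rightarrow> (nat \<Rightarrow> complex) \<Rightarrow> (nat \<Rightarrow> complex)" where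
  "lift_operator A c = code (A (decode c))"

lemma set_integrable_test:
  assumes "g \<in> square_integrable M"
  shows "set_integrable M (T n) g"
  using integrable_mult_cnj[OF assms square_integrable_indicator[OF T_sets[of n] T_finite]]
  by (simp add: set_integrable_def scaleR_conv_of_real mult.commute)

lemma code_zero: "code (\<lambda>x. 0) = (\<lambda>n. 0)"
  by (simp add: code_def set_lebesgue_integral_def)

lemma code_add:
  assumes "f \<in> square_integrable M" "g \<in> square_integrable M"
  shows "code (\<lambda>x. f x + g x) = (\<lambda>n. code f n + code g n)"
  using assms[THEN set_integrable_test] by (auto simp: code_def fun_eq_iff set_integral_add)

lemma code_diff:
  assumes "f \<in> square_integrable M" "g \<in> square_integrable M"
  shows "code (\<lambda>x. f x - g x) = (\<lambda>n. code f n - code g n)"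
  using assms[THEN set_integrable_test] by (auto simp: code_def fun_eq_iff set_integral_diff)

lemma code_scale: "code (\<lambda>x. a * f x) = (\<lambda>n. a * code f n)"
  by (simp add: code_def)

lemma code_eq_iff:
  assumes f: "f \<in> square_integrable M" and g: "g \<in> square_integrable M"
  shows "code f = code g \<longleftrightarrow> (AE x in M. f x = g x)"
proof
  assume eq: "code f = code g"
  have "AE x in M. f x - g x = 0"
  proof (rule T_total)
    show "(LINT x:T n|M. f x - g x) = 0" for n
      using code_diff[OF f g] eq by (simp add: code_def fun_eq_iff)
  qed (rule square_integrable_diff[OF f g])
  then show "AE x in M. f x = g x" by simp
next
  note [measurable] = f[THEN square_integrable_measurable] g[THEN square_integrable_measurable] T_sets
  assume ae: "AE x in M. f x = g x"
  show "code f = code g"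
  proof
    fix n
    from ae show "code f n = code g n"
      unfolding code_def set_lebesgue_integral_def
      by (intro integral_cong_AE) auto
  qed
qed

lemma decode_code:
  assumes "g \<in> square_integrable M"
  shows "decode (code g) \<in> square_integrable M" "code (decode (code g)) = code g"
    "AE x in M. decode (code g) x = g x"
proof -
  have "decode (code g) \<in> square_integrable M \<and> code (decode (code g)) = code g"
    unfolding decode_def by (rule someI[of _ g]) (use assms in auto)
  then show *: "decode (code g) \<in> square_integrable M" "code (decode (code g)) = code g"
    by auto
  then show "AE x in M. decode (code g) x = g x"
    using code_eq_iff assms by blast
qed

lemma pts_L2_space: "pts L2_space = code ` square_integrable M"
  by (simp add: L2_space_def)

lemma vadd_code:
  assumes "f \<in> square_integrable M" "g \<in> square_integrable M"
  shows "vadd L2_space (code f) (code g) = code (\<lambda>x. f x + g x)"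
  by (simp add: L2_space_def code_add assms)

lemma vscale_code: "vscale L2_space a (code f) = code (\<lambda>x. a * f x)"
  by (simp add: L2_space_def code_scale)

lemma vip_code:
  assumes f: "f \<in> square_integrable M" and g: "g \<in> square_integrable M"
  shows "vip L2_space (code f) (code g) = (\<integral>x. f x * cnj (g x) \<partial>M)"
proof -
  note [measurable] = f[THEN square_integrable_measurable] g[THEN square_integrable_measurable]
    decode_code(1)[OF f, THEN square_integrable_measurable]
    decode_code(1)[OF g, THEN square_integrable_measurable]
  show ?thesis
    unfolding L2_space_def cspace.simps
  proof (rule integral_cong_AE)
    show "AE x in M. decode (code f) x * cnj (decode (code g) x) = f x * cnj (g x)"
      using decode_code(3)[OF f] decode_code(3)[OF g] by eventually_elim simp
  qed measurable
qed

lemma vip_self_code: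
  assumes "f \<in> square_integrable M"
  shows "vip L2_space (code f) (code f) = of_real ((L2_norm M f)\<^sup>2)"
  unfolding vip_code[OF assms assms] L2_norm_square
  by (simp only: complex_norm_square[symmetric] of_real_power[symmetric] integral_complex_of_real)

lemma vnorm_code: "f \<in> square_integrable M \<Longrightarrow> vnorm L2_space (code f) = L2_norm M f"
  by (simp add: vnorm_def vip_self_code L2_norm_nonneg flip: of_real_power)

lemma vdist_code:
  assumes "f \<in> square_integrable M" "g \<in> square_integrable M"
  shows "vdist L2_space (code f) (code g) = L2_norm M (\<lambda>x. f x - g x)"
  using vadd_code[OF assms(1) square_integrable_scale[OF assms(2), of "-1"]]
  by (simp add: vdist_def vscale_code vnorm_code square_integrable_diff assms)

text \<open>The triangle inequality is inherited from \<^const>\<open>L2_norm\<close>, and points at distance \<open>0\<close> coincide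
  because the code does not distinguish functions that agree almost everywhere.\<close>

lemma Metric_space_L2: "Metric_space (pts L2_space) (vdist L2_space)"
proof (rule Metric_space.intro)
  show "0 \<le> vdist L2_space c d" for c d
  proof -
    have "0 \<le> Re (vip L2_space e e)" for e
    proof -
      have "vip L2_space e e = of_real (\<integral>x. (cmod (decode e x))\<^sup>2 \<partial>M)"
        by (simp add: L2_space_def flip: complex_norm_square of_real_power integral_complex_of_real)
      then show ?thesis by simp
    qed
    then show ?thesis by (simp add: vdist_def vnorm_def)
  qed
  \<comment> \<open>Symmetry is demanded on the whole type: if the difference is no code, both sides decode
    to the same arbitrary function.\<close>
  show "vdist L2_space c d = vdist L2_space d c" for c d
  proof (cases "(\<lambda>n. c n - d n) \<in> pts L2_space")
    case True
    then obtain g where g: "g \<in> square_integrable M" "(\<lambda>n. c n - d n) = code g"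
      by (auto simp: pts_L2_space)
    have "(\<lambda>n. d n - c n) = code (\<lambda>x. - 1 * g x)"
      unfolding code_scale g(2)[symmetric] by simp
    then have "vdist L2_space d c = L2_norm M (\<lambda>x. - 1 * g x)"
      using vnorm_code[OF square_integrable_scale[OF g(1), of "-1"]]
      by (simp add: vdist_def L2_space_def)
    also have "\<dots> = vdist L2_space c d"
      using vnorm_code[OF g(1)] g(2) by (simp add: vdist_def L2_space_def L2_norm_def)
    finally show ?thesis by simp
  next
    case False
    have neg: "(\<lambda>n. c n - d n) \<in> pts L2_space" if not_code: "(\<lambda>n. d n - c n) \<in> pts L2_space"
    proof -
      from not_code obtain g where g: "g \<in> square_integrable M" "(\<lambda>n. d n - c n) = code g"
        by (auto simp: pts_L2_space)
      have "(\<lambda>n. c n - d n) = code (\<lambda>x. - 1 * g x)"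
        unfolding code_scale g(2)[symmetric] by simp
      then show ?thesis
        using square_integrable_scale[OF g(1), of "-1"] by (auto simp: pts_L2_space)
    qed
    have "decode e = (SOME g. False)" if "e \<notin> pts L2_space" for e
      using that by (auto simp: decode_def pts_L2_space intro!: arg_cong[where f=Eps])
    then have "decode (\<lambda>n. c n - d n) = decode (\<lambda>n. d n - c n)"
      using False neg by metis
    then show ?thesis
      by (simp add: vdist_def vnorm_def L2_space_def)
  qed
  show "vdist L2_space c d = 0 \<longleftrightarrow> c = d" if "c \<in> pts L2_space" "d \<in> pts L2_space" for c d
    using that by (auto simp: pts_L2_space vdist_code L2_norm_eq_0_iff square_integrable_diff code_eq_iff)
  show "vdist L2_space c e \<le> vdist L2_space c d + vdist L2_space d e"
    if "c \<in> pts L2_space" "d \<in> pts L2_space" "e \<in> pts L2_space" for c d e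
  proof -
    from that obtain f g h where "f \<in> square_integrable M" "c = code f"
      "g \<in> square_integrable M" "d = code g" "h \<in> square_integrable M" "e = code h"
      by (auto simp: pts_L2_space)
    then show ?thesis
      using L2_norm_triangle[of "\<lambda>x. f x - g x" M "\<lambda>x. g x - h x"]
      by (simp add: vdist_code square_integrable_diff)
  qed
qed

theorem complex_hilbert_space_L2: "complex_hilbert_space L2_space"
proof
  interpret Metric_space "pts L2_space" "vdist L2_space" by (rule Metric_space_L2)
  show "mcomplete"
    unfolding mcomplete_def
  proof (intro allI impI)
    fix c assume "MCauchy c"
    then have c: "range c \<subseteq> pts L2_space"
      and Cauchy: "\<And>\<epsilon>. \<epsilon> > 0 \<Longrightarrow> \<exists>N. \<forall>n n'. N \<le> n \<longrightarrow> N \<le> n' \<longrightarrow> vdist L2_space (c n) (c n') < \<epsilon>"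
      by (auto simp: MCauchy_def)
    from c have "\<forall>n. \<exists>g. g \<in> square_integrable M \<and> c n = code g"
      by (auto simp: pts_L2_space)
    then obtain g where g: "\<And>n. g n \<in> square_integrable M" "\<And>n. c n = code (g n)"
      by metis
    obtain h where h: "h \<in> square_integrable M"
      "\<forall>\<epsilon>>0. \<exists>N. \<forall>n\<ge>N. L2_norm M (\<lambda>x. g n x - h x) < \<epsilon>"
      using Riesz_Fischer[of g M] Cauchy by (auto simp: g vdist_code)
    then have "limitin mtopology c (code h) sequentially"
      unfolding limit_metric_sequentially by (auto simp: g vdist_code pts_L2_space)
    then show "\<exists>l. limitin mtopology c l sequentially" by (rule exI[of _ "code h"])
  qed
next
  show "vzero L2_space \<in> pts L2_space"
    using square_integrable_zero code_zero by (force simp: L2_space_def)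
  show "vadd L2_space c d \<in> pts L2_space" if "c \<in> pts L2_space" "d \<in> pts L2_space" for c d
    using that by (auto simp: pts_L2_space vadd_code square_integrable_add)
  show "vscale L2_space a c \<in> pts L2_space" if "c \<in> pts L2_space" for a c
    using that by (auto simp: pts_L2_space vscale_code square_integrable_scale)
  show "\<exists>d\<in>pts L2_space. vadd L2_space c d = vzero L2_space" if c: "c \<in> pts L2_space" for c
  proof -
    from c obtain g where g: "g \<in> square_integrable M" "c = code g"
      by (auto simp: pts_L2_space)
    show ?thesis
    proof (rule bexI)
      show "code (\<lambda>x. - 1 * g x) \<in> pts L2_space"
        using square_integrable_scale[OF g(1), of "-1"] by (auto simp only: pts_L2_space)
      show "vadd L2_space c (code (\<lambda>x. - 1 * g x)) = vzero L2_space"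
        unfolding code_scale g(2) by (simp add: L2_space_def)
    qed
  qed
  show "vip L2_space (vadd L2_space c d) e = vip L2_space c e + vip L2_space d e"
    if "c \<in> pts L2_space" "d \<in> pts L2_space" "e \<in> pts L2_space" for c d e
    using that by (auto simp: pts_L2_space vadd_code square_integrable_add vip_code
        distrib_right integrable_mult_cnj)
  show "vip L2_space (vscale L2_space a c) d = a * vip L2_space c d"
    if "c \<in> pts L2_space" "d \<in> pts L2_space" for a c d
    using that by (auto simp: pts_L2_space vscale_code square_integrable_scale vip_code mult.assoc)
  show "vip L2_space d c = cnj (vip L2_space c d)"
    if "c \<in> pts L2_space" "d \<in> pts L2_space" for c d
  proof -
    from that obtain f g where fg: "f \<in> square_integrable M" "c = code f"
      "g \<in> square_integrable M" "d = code g"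
      by (auto simp: pts_L2_space)
    have "cnj (\<integral>x. f x * cnj (g x) \<partial>M) = (\<integral>x. cnj (f x * cnj (g x)) \<partial>M)"
      by (rule Bochner_Integration.integral_cnj[symmetric])
    then show ?thesis using fg by (simp add: vip_code mult.commute)
  qed
  show "0 \<le> Re (vip L2_space c c)" if "c \<in> pts L2_space" for c
    using that by (auto simp: pts_L2_space vip_self_code simp flip: of_real_power)
  show "c = vzero L2_space" if "c \<in> pts L2_space" "vip L2_space c c = 0" for c
  proof -
    from that obtain g where g: "g \<in> square_integrable M" "c = code g"
      by (auto simp: pts_L2_space)
    with that have "AE x in M. g x = 0"
      by (simp add: vip_self_code L2_norm_eq_0_iff)
    then have "c = code (\<lambda>x. 0)"
      using g code_eq_iff[OF g(1) square_integrable_zero] by simp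
    then show ?thesis by (simp add: code_zero L2_space_def)
  qed
qed (auto simp: L2_space_def algebra_simps)

text \<open>An operator that respects almost-everywhere equality is compatible with the choice of
  representatives.\<close>

lemma lift_operator_code:
  assumes "g \<in> square_integrable M"
    and "\<And>f g. AE x in M. f x = g x \<Longrightarrow> AE x in M. A f x = A g x"
    and "\<And>f. f \<in> square_integrable M \<Longrightarrow> A f \<in> square_integrable M"
  shows "lift_operator A (code g) = code (A g)"
  unfolding lift_operator_def
  by (subst code_eq_iff) (use assms decode_code in blast)+

abbreviation "composition_operator u \<tau> \<equiv> lift_operator (weighted_composition u \<tau>)"

lemma composition_operator_code:
  assumes "multiplier M u" "measure_preserving M \<tau>" "g \<in> square_integrable M"
  shows "weighted_composition u \<tau> g \<in> square_integrable M"
    "composition_operator u \<tau> (code g) = code (weighted_composition u \<tau> g)"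
proof -
  have *: "weighted_composition u \<tau> g \<in> square_integrable M"
    if "g \<in> square_integrable M" for g
    using weighted_composition_bound[OF assms(1,2)] that by blast
  show "weighted_composition u \<tau> g \<in> square_integrable M"
    by (rule *[OF assms(3)])
  show "composition_operator u \<tau> (code g) = code (weighted_composition u \<tau> g)"
  proof (rule lift_operator_code[OF assms(3) _ *])
    fix f h :: "'a \<Rightarrow> complex" assume "AE x in M. f x = h x"
    from AE_measure_preserving[OF assms(2) this]
    show "AE x in M. weighted_composition u \<tau> f x = weighted_composition u \<tau> h x"
      by eventually_elim (simp add: weighted_composition_def)
  qed
qed

lemma bounded_composition_operator:
  assumes "multiplier M u" "measure_preserving M \<tau>"
  shows "bounded_operator L2_space (composition_operator u \<tau>)"
proof -
  note cc = composition_operator_code[OF assms]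
  obtain C where C: "\<forall>g\<in>square_integrable M. L2_norm M (weighted_composition u \<tau> g) \<le> C * L2_norm M g"
    using weighted_composition_bound[OF assms] by blast
  have "linear_map L2_space L2_space (composition_operator u \<tau>)"
    unfolding linear_map_def pts_L2_space
  proof (intro conjI ballI allI; elim imageE; clarify)
    fix f g :: "'a \<Rightarrow> complex" assume "f \<in> square_integrable M" "g \<in> square_integrable M"
    then show "composition_operator u \<tau> (vadd L2_space (code f) (code g)) =
        vadd L2_space (composition_operator u \<tau> (code f)) (composition_operator u \<tau> (code g))"
      by (simp add: vadd_code cc square_integrable_add)
         (simp add: weighted_composition_def[abs_def] distrib_left)
  next
    fix a and f :: "'a \<Rightarrow> complex" assume "f \<in> square_integrable M"
    then show "composition_operator u \<tau> (vscale L2_space a (code f)) =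
        vscale L2_space a (composition_operator u \<tau> (code f))"
      by (simp add: vscale_code cc square_integrable_scale)
         (simp add: weighted_composition_def[abs_def] mult.left_commute)
  qed (simp add: cc)
  moreover have "\<forall>c\<in>pts L2_space. vnorm L2_space (composition_operator u \<tau> c) \<le> C * vnorm L2_space c"
    using C by (auto simp: pts_L2_space cc vnorm_code)
  ultimately show ?thesis unfolding bounded_operator_def by blast
qed

text \<open>Substituting \<open>\<tau>'\<close> for the variable shows that the adjoint of \<open>g \<mapsto> u \<cdot> (g \<circ> \<tau>)\<close> is
  \<open>g \<mapsto> (u \<circ> \<tau>') \<cdot> (g \<circ> \<tau>')\<close>. When \<open>u\<close> is \<open>\<tau>\<close>-invariant, both products of the two operators are multiplication by
  \<open>u\<^sup>2\<close>.\<close>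

lemma normal_composition_operator:
  assumes u: "multiplier M u" and \<tau>: "measure_preserving M \<tau>" and \<tau>': "measure_preserving M \<tau>'"
    and inv: "\<And>x. \<tau> (\<tau>' x) = x" "\<And>x. \<tau>' (\<tau> x) = x"
    and invariant: "\<And>x. u (\<tau> x) = u x"
  shows "normal_operator L2_space (composition_operator u \<tau>)"
proof -
  note cc = composition_operator_code[OF u \<tau>] composition_operator_code[OF u \<tau>']
  have invariant': "u (\<tau>' x) = u x" for x
    using invariant[of "\<tau>' x"] inv by simp
  have adj: "vip L2_space (composition_operator u \<tau> (code f)) (code g) =
    vip L2_space (code f) (composition_operator u \<tau>' (code g))"
    if f: "f \<in> square_integrable M" and g: "g \<in> square_integrable M" for f g
  proof -
    note [measurable] = f[THEN square_integrable_measurable] g[THEN square_integrable_measurable]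
    have [measurable]: "u \<in> borel_measurable M" "\<tau> \<in> measurable M M"
      using u \<tau> by (auto simp: multiplier_def measure_preserving_def)
    have "(\<integral>x. weighted_composition u \<tau> f x * cnj (g x) \<partial>M)
      = (\<integral>x. weighted_composition u \<tau> f (\<tau>' x) * cnj (g (\<tau>' x)) \<partial>M)"
      by (rule integral_measure_preserving[OF \<tau>', symmetric])
         (simp add: weighted_composition_def[abs_def])
    then show ?thesis
      by (simp add: vip_code cc f g)
         (simp add: weighted_composition_def inv invariant' mult_ac)
  qed
  have "adjoint_of L2_space (composition_operator u \<tau>) (composition_operator u \<tau>')"
    using adj bounded_composition_operator[OF u \<tau>'] by (auto simp: adjoint_of_def pts_L2_space)
  moreover have "operators_commute L2_space (composition_operator u \<tau>) (composition_operator u \<tau>')"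
    by (auto simp: operators_commute_def pts_L2_space cc)
       (simp add: weighted_composition_def[abs_def] inv invariant invariant')
  ultimately show ?thesis
    using bounded_composition_operator[OF u \<tau>] by (auto simp: normal_operator_def)
qed

lemma commuting_composition_operators:
  assumes "multiplier M u" "measure_preserving M \<tau>" "multiplier M v" "measure_preserving M \<rho>"
    and "\<And>x. \<tau> (\<rho> x) = \<rho> (\<tau> x)" "\<And>x. u (\<rho> x) = u x" "\<And>x. v (\<tau> x) = v x"
  shows "operators_commute L2_space (composition_operator u \<tau>) (composition_operator v \<rho>)"
  by (auto simp: operators_commute_def pts_L2_space
      composition_operator_code[OF assms(1,2)] composition_operator_code[OF assms(3,4)])
     (simp add: weighted_composition_def[abs_def] assms mult_ac)

end

section \<open>Weighted shifts on square-summable families\<close>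

lemma vnorm_ell2: "vnorm ell2 x = sqrt (\<Sum>\<^sub>\<infinity>i. (cmod (x i))\<^sup>2)"
proof -
  have "vip ell2 x x = (\<Sum>\<^sub>\<infinity>i. complex_of_real ((cmod (x i))\<^sup>2))"
    by (simp only: ell2_def cspace.simps complex_norm_square)
  also have "\<dots> = complex_of_real (\<Sum>\<^sub>\<infinity>i. (cmod (x i))\<^sup>2)"
  proof (cases "(\<lambda>i. (cmod (x i))\<^sup>2) summable_on UNIV")
    case True
    then show ?thesis
      using has_sum_infsum has_sum_of_real infsumI by blast
  next
    case False
    then have "\<not> (\<lambda>i. complex_of_real ((cmod (x i))\<^sup>2)) summable_on UNIV"
      using summable_on_Re[of "\<lambda>i. complex_of_real ((cmod (x i))\<^sup>2)" UNIV] by auto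
    with False show ?thesis by (simp add: infsum_not_exists)
  qed
  finally show ?thesis by (simp add: vnorm_def)
qed

text \<open>The two coordinate shifts are instances: each sends the unit vector at \<open>i\<close> to a multiple of the
  unit vector at \<open>s i\<close>, so boundedness and the comparison of weights and norm are proved once.\<close>

locale injective_shift =
  fixes s :: "'i \<Rightarrow> 'i" and w :: "'i \<Rightarrow> real" and C :: real
    and S :: "('i \<Rightarrow> complex) \<Rightarrow> ('i \<Rightarrow> complex)"
  assumes inj: "inj s" and weight_bound: "\<bar>w i\<bar> \<le> C"
    and shift_range: "S x (s i) = of_real (w i) * x i"
    and shift_outside: "k \<notin> range s \<Longrightarrow> S x k = 0"
begin

lemma shift_square_sum:
  "(\<lambda>k. (cmod (S x k))\<^sup>2) summable_on UNIV \<longleftrightarrow> (\<lambda>i. (w i)\<^sup>2 * (cmod (x i))\<^sup>2) summable_on UNIV"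
  "(\<Sum>\<^sub>\<infinity>k. (cmod (S x k))\<^sup>2) = (\<Sum>\<^sub>\<infinity>i. (w i)\<^sup>2 * (cmod (x i))\<^sup>2)"
proof -
  have eq: "(\<lambda>k. (cmod (S x k))\<^sup>2) \<circ> s = (\<lambda>i. (w i)\<^sup>2 * (cmod (x i))\<^sup>2)"
    by (auto simp: shift_range norm_mult power_mult_distrib)
  have "(\<lambda>k. (cmod (S x k))\<^sup>2) summable_on UNIV \<longleftrightarrow> (\<lambda>k. (cmod (S x k))\<^sup>2) summable_on range s"
    by (rule summable_on_cong_neutral) (auto simp: shift_outside)
  then show "(\<lambda>k. (cmod (S x k))\<^sup>2) summable_on UNIV \<longleftrightarrow> (\<lambda>i. (w i)\<^sup>2 * (cmod (x i))\<^sup>2) summable_on UNIV"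
    by (simp only: summable_on_reindex[OF inj] eq)
  have "(\<Sum>\<^sub>\<infinity>k. (cmod (S x k))\<^sup>2) = (\<Sum>\<^sub>\<infinity>k\<in>range s. (cmod (S x k))\<^sup>2)"
    by (rule infsum_cong_neutral) (auto simp: shift_outside)
  then show "(\<Sum>\<^sub>\<infinity>k. (cmod (S x k))\<^sup>2) = (\<Sum>\<^sub>\<infinity>i. (w i)\<^sup>2 * (cmod (x i))\<^sup>2)"
    by (simp only: infsum_reindex[OF inj] eq)
qed

lemma shift_bound:
  assumes x: "x \<in> pts ell2"
  shows "S x \<in> pts ell2" "vnorm ell2 (S x) \<le> C * vnorm ell2 x"
proof -
  have C: "0 \<le> C" using weight_bound[of undefined] by simp
  have le: "(w i)\<^sup>2 * (cmod (x i))\<^sup>2 \<le> C\<^sup>2 * (cmod (x i))\<^sup>2" for i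
    using weight_bound[of i] C by (intro mult_right_mono) (auto intro: abs_le_square_iff[THEN iffD1])
  have sx: "(\<lambda>i. C\<^sup>2 * (cmod (x i))\<^sup>2) summable_on UNIV"
    using x by (intro summable_on_cmult_right) (simp add: ell2_def)
  have sw: "(\<lambda>i. (w i)\<^sup>2 * (cmod (x i))\<^sup>2) summable_on UNIV"
    by (rule summable_on_comparison_test[OF sx le]) auto
  then show "S x \<in> pts ell2"
    by (simp add: ell2_def shift_square_sum)
  have "(\<Sum>\<^sub>\<infinity>i. (w i)\<^sup>2 * (cmod (x i))\<^sup>2) \<le> C\<^sup>2 * (\<Sum>\<^sub>\<infinity>i. (cmod (x i))\<^sup>2)"
    using infsum_mono[OF sw sx le] by (simp add: infsum_cmult_right')
  then have "sqrt (\<Sum>\<^sub>\<infinity>i. (w i)\<^sup>2 * (cmod (x i))\<^sup>2) \<le> sqrt (C\<^sup>2 * (\<Sum>\<^sub>\<infinity>i. (cmod (x i))\<^sup>2))"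
    by (rule real_sqrt_le_mono)
  then show "vnorm ell2 (S x) \<le> C * vnorm ell2 x"
    using C by (simp add: vnorm_ell2 shift_square_sum real_sqrt_mult)
qed

lemma bounded_shift: "bounded_operator ell2 S"
proof -
  have add: "S (\<lambda>i. x i + y i) = (\<lambda>k. S x k + S y k)" for x y
  proof
    fix k show "S (\<lambda>i. x i + y i) k = S x k + S y k"
      by (cases "k \<in> range s") (auto simp: shift_range shift_outside distrib_left)
  qed
  have scale: "S (\<lambda>i. a * x i) = (\<lambda>k. a * S x k)" for a x
  proof
    fix k show "S (\<lambda>i. a * x i) k = a * S x k"
      by (cases "k \<in> range s") (auto simp: shift_range shift_outside)
  qed
  have "linear_map ell2 ell2 S"
    unfolding linear_map_def using shift_bound(1) by (simp add: add scale) (simp add: ell2_def add scale)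
  then show ?thesis
    unfolding bounded_operator_def using shift_bound(2) by blast
qed

text \<open>The shift sends the unit vector at \<open>i\<close> to a vector of norm \<open>\<bar>w i\<bar>\<close>.\<close>

lemma weight_le_operator_norm: "\<bar>w i\<bar> \<le> operator_norm ell2 S"
proof -
  let ?e = "\<lambda>j. if j = i then 1 else 0 :: complex"
  have sq: "(cmod (?e j))\<^sup>2 = (if j = i then 1 else 0)" for j by simp
  have fin: "(\<lambda>j. if j = i then c else 0 :: real) summable_on UNIV"
    "(\<Sum>\<^sub>\<infinity>j. if j = i then c else 0 :: real) = c" for c
  proof -
    have "((\<lambda>j. if j = i then c else 0 :: real) has_sum c) UNIV"
      by (rule has_sum_finite_neutralI[of "{i}"]) auto
    then show "(\<lambda>j. if j = i then c else 0 :: real) summable_on UNIV"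
      "(\<Sum>\<^sub>\<infinity>j. if j = i then c else 0 :: real) = c"
      by (auto intro: infsumI simp: summable_on_def)
  qed
  have e: "?e \<in> pts ell2" "vnorm ell2 ?e = 1"
  proof -
    show "?e \<in> pts ell2" using fin(1)[of 1] by (simp add: ell2_def sq)
    show "vnorm ell2 ?e = 1" using fin(2)[of 1] by (simp add: vnorm_ell2 sq)
  qed
  have "(\<Sum>\<^sub>\<infinity>j. (w j)\<^sup>2 * (cmod (?e j))\<^sup>2) = (\<Sum>\<^sub>\<infinity>j. if j = i then (w i)\<^sup>2 else 0)"
    by (rule infsum_cong) auto
  then have "vnorm ell2 (S ?e) = \<bar>w i\<bar>"
    using fin(2)[of "(w i)\<^sup>2"] by (simp add: vnorm_ell2 shift_square_sum)
  moreover have "bdd_above {vnorm ell2 (S x) | x. x \<in> pts ell2 \<and> vnorm ell2 x \<le> 1}"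
  proof (rule bdd_aboveI)
    fix v assume "v \<in> {vnorm ell2 (S x) | x. x \<in> pts ell2 \<and> vnorm ell2 x \<le> 1}"
    then obtain x where x: "x \<in> pts ell2" "vnorm ell2 x \<le> 1" "v = vnorm ell2 (S x)" by blast
    have "0 \<le> C" using weight_bound[of undefined] by simp
    then show "v \<le> C"
      using shift_bound(2)[OF x(1)] x mult_left_mono[OF x(2), of C] by simp
  qed
  ultimately show ?thesis
    unfolding operator_norm_def using e by (intro cSup_upper) (auto intro!: exI[of _ ?e])
qed

end

lemma weight_families_bounded:
  assumes "weight_families \<alpha> \<beta>"
  obtains A B where "\<And>k. \<bar>\<alpha> k\<bar> \<le> A" "\<And>k. \<bar>\<beta> k\<bar> \<le> B"
  using assms by (auto simp: weight_families_def bounded_iff) 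

lemma injective_shift1:
  assumes "\<And>k. \<bar>\<alpha> k\<bar> \<le> A"
  shows "injective_shift (\<lambda>(i, j). (Suc i, j)) \<alpha> A (shift1 \<alpha>)"
proof
  show "shift1 \<alpha> x k = 0" if "k \<notin> range (\<lambda>(i, j). (Suc i, j))" for x k
    using that by (cases k) (force simp: shift1_def split: nat.split)
qed (use assms in \<open>auto simp: inj_def shift1_def\<close>)

lemma injective_shift2:
  assumes "\<And>k. \<bar>\<beta> k\<bar> \<le> B"
  shows "injective_shift (\<lambda>(i, j). (i, Suc j)) \<beta> B (shift2 \<beta>)"
proof
  show "shift2 \<beta> x k = 0" if "k \<notin> range (\<lambda>(i, j). (i, Suc j))" for x k
    using that by (cases k) (force simp: shift2_def split: nat.split)
qed (use assms in \<open>auto simp: inj_def shift2_def\<close>)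

lemma shifts_commute:
  assumes "weight_families \<alpha> \<beta>"
  shows "operators_commute H (shift1 \<alpha>) (shift2 \<beta>)"
proof -
  have comm: "complex_of_real (\<alpha> (i, Suc j)) * complex_of_real (\<beta> (i, j)) =
      complex_of_real (\<beta> (Suc i, j)) * complex_of_real (\<alpha> (i, j))" for i j
    using assms by (simp add: weight_families_def flip: of_real_mult)
  show ?thesis
    by (auto simp: operators_commute_def shift1_def shift2_def fun_eq_iff comm mult.assoc[symmetric]
        split: nat.split)
qed

lemma moment2_pos:
  assumes "weight_families \<alpha> \<beta>"
  shows "0 < moment2 \<alpha> \<beta> i j"
  using assms unfolding weight_families_def moment2_def
  by (intro mult_pos_pos prod_pos zero_less_power) auto

lemma moment2_Suc_right: "moment2 \<alpha> \<beta> i (Suc j) = (\<beta> (i, j))\<^sup>2 * moment2 \<alpha> \<beta> i j"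
  by (simp add: moment2_def)

text \<open>\<^const>\<open>moment2\<close> follows the path that goes right first, so a last step to the right is only
  available through the commutation relation, used once for each step up.\<close>

lemma moment2_Suc_left:
  assumes "weight_families \<alpha> \<beta>"
  shows "moment2 \<alpha> \<beta> (Suc i) j = (\<alpha> (i, j))\<^sup>2 * moment2 \<alpha> \<beta> i j"
proof (induction j)
  case 0
  then show ?case by (simp add: moment2_def)
next
  case (Suc j)
  have "(\<beta> (Suc i, j))\<^sup>2 * (\<alpha> (i, j))\<^sup>2 = (\<alpha> (i, Suc j))\<^sup>2 * (\<beta> (i, j))\<^sup>2"
    using assms by (simp add: weight_families_def flip: power_mult_distrib)
  with Suc show ?case
    by (simp add: moment2_Suc_right mult.assoc[symmetric])
qed

section \<open>Countably many copies of a probability measure on the line\<close>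

text \<open>The positive and negative parts of \<open>h\<close> are densities of two finite measures that agree on the
  half-lines with rational endpoint. These are closed under intersection and generate the Borel
  sets, so the measures, and with them the densities, are equal.\<close>

lemma AE_zero_of_half_line_integrals:
  fixes h :: "real \<Rightarrow> real"
  assumes fin: "finite_measure \<sigma>" and sets: "sets \<sigma> = sets borel" and h: "integrable \<sigma> h"
    and zero: "\<And>q::rat. (LINT x:{of_rat q<..}|\<sigma>. h x) = 0"
  shows "AE x in \<sigma>. h x = 0"
proof -
  interpret finite_measure \<sigma> by fact
  have [measurable]: "h \<in> borel_measurable \<sigma>" using h by simp
  have [simp]: "space \<sigma> = UNIV" using sets_eq_imp_space_eq[OF sets] by simp
  let ?P = "density \<sigma> (\<lambda>x. ennreal (h x))" and ?N = "density \<sigma> (\<lambda>x. ennreal (- h x))"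
  let ?E = "range (\<lambda>q::rat. {real_of_rat q<..})"
  have meas: "{real_of_rat q<..} \<in> sets \<sigma>" for q by (simp add: sets)
  have emeasure_half_line: "emeasure (density \<sigma> (\<lambda>x. ennreal (f x))) {real_of_rat q<..}
      = ennreal (\<integral>x. indicator {real_of_rat q<..} x * max 0 (f x) \<partial>\<sigma>)"
    if "integrable \<sigma> f" for f q
  proof -
    have "integrable \<sigma> (\<lambda>x. indicator {real_of_rat q<..} x * max 0 (f x))"
      using integrable_mult_indicator[OF meas, of "\<lambda>x. max 0 (f x)" q] that by simp
    moreover have "emeasure (density \<sigma> (\<lambda>x. ennreal (f x))) {real_of_rat q<..}
      = (\<integral>\<^sup>+x. ennreal (indicator {real_of_rat q<..} x * max 0 (f x)) \<partial>\<sigma>)"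
      using that meas by (subst emeasure_density)
        (auto intro!: nn_integral_cong simp: indicator_def ennreal_max_0)
    ultimately show ?thesis by (simp add: nn_integral_eq_integral)
  qed
  have "?P = ?N"
  proof (rule measure_eqI_generator_eq_countable[where E="?E" and A="?E" and \<Omega>=UNIV])
    show "Int_stable ?E"
    proof (rule Int_stableI_image)
      fix q q' :: rat
      show "\<exists>r\<in>UNIV. {real_of_rat q<..} \<inter> {real_of_rat q'<..} = {real_of_rat r<..}"
        by (rule bexI[of _ "max q q'"]) (use of_rat_less_eq[of q q', where 'a=real] of_rat_less[of q' q, where 'a=real]
            in \<open>auto simp: max_def not_le\<close>)
    qed
    \<comment> \<open>An open half-line is the union of the rational ones inside it.\<close>
    have borel: "sets borel = sigma_sets UNIV ?E"
    proof
      have "borel = sigma UNIV (range (greaterThan :: real \<Rightarrow> real set))"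
        by (rule borel_Ioi)
      then have "sets (borel :: real measure) = sigma_sets UNIV (range greaterThan)"
        by (metis sets_measure_of subset_UNIV Pow_UNIV)
      also have "\<dots> \<subseteq> sigma_sets UNIV ?E"
      proof (rule sigma_sets_mono, clarify)
        fix x :: real
        have "{x<..} = (\<Union>q\<in>{q::rat. x < of_rat q}. {real_of_rat q<..})"
          using of_rat_dense by (force intro: less_trans)
        also have "\<dots> \<in> sigma_sets UNIV ?E"
          by (rule sigma_sets_UNION) auto
        finally show "{x<..} \<in> sigma_sets UNIV ?E" .
      qed
      finally show "sets borel \<subseteq> sigma_sets UNIV ?E" .
      show "sigma_sets UNIV ?E \<subseteq> sets borel"
      proof -
        have "?E \<subseteq> sets borel" by auto
        from sets.sigma_sets_subset[OF this] show ?thesis by simp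
      qed
    qed
    show "sets ?P = sigma_sets UNIV ?E" "sets ?N = sigma_sets UNIV ?E"
      using borel by (simp_all add: sets)
    show "\<Union> ?E = UNIV"
    proof (intro set_eqI iffI UNIV_I)
      fix x :: real
      obtain q :: rat where "of_rat q < x" using of_rat_dense[of "x - 1" x] by auto
      then show "x \<in> \<Union> ?E" by auto
    qed
    show "emeasure ?P X \<noteq> \<infinity>" if "X \<in> ?E" for X
      using that h by (auto simp: emeasure_half_line)
    show "emeasure ?P X = emeasure ?N X" if "X \<in> ?E" for X
    proof -
      from that obtain q :: rat where X: "X = {real_of_rat q<..}" by auto
      let ?i = "\<lambda>x. indicator {real_of_rat q<..} x :: real"
      have "integrable \<sigma> (\<lambda>x. ?i x * max 0 (h x))" "integrable \<sigma> (\<lambda>x. ?i x * max 0 (- h x))"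
        using integrable_mult_indicator[OF meas, of "\<lambda>x. max 0 (h x)" q]
          integrable_mult_indicator[OF meas, of "\<lambda>x. max 0 (- h x)" q] h by simp_all
      then have "(\<integral>x. ?i x * max 0 (h x) \<partial>\<sigma>) - (\<integral>x. ?i x * max 0 (- h x) \<partial>\<sigma>)
        = (\<integral>x. ?i x * max 0 (h x) - ?i x * max 0 (- h x) \<partial>\<sigma>)"
        by simp
      also have "\<dots> = (LINT x:{real_of_rat q<..}|\<sigma>. h x)"
        unfolding set_lebesgue_integral_def by (rule Bochner_Integration.integral_cong) (auto simp: max_def algebra_simps)
      also have "\<dots> = 0" by (rule zero)
      finally show ?thesis using h by (simp add: X emeasure_half_line)
    qed
  qed auto
  then have "AE x in \<sigma>. ennreal (h x) = ennreal (- h x)"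
    by (subst (asm) density_unique_iff) auto
  then show ?thesis
  proof eventually_elim
    case (elim x)
    then have "max 0 (h x) = max 0 (- h x)"
      by (metis enn2real_ennreal ennreal_max_0 max.cobounded1)
    then show ?case by (simp add: max_def split: if_splits)
  qed
qed

text \<open>The natural number enumerates pairs of a fiber and a rational endpoint.\<close>

definition half_line_fiber :: "nat \<Rightarrow> ('k :: countable \<times> real) set" where
  "half_line_fiber n = (case from_nat n of (k, q) \<Rightarrow> {k} \<times> {real_of_rat q<..})"

lemma half_line_fiber_to_nat:
  "half_line_fiber (to_nat (k, q)) = {k} \<times> {real_of_rat q<..}"
  by (simp add: half_line_fiber_def)

locale fibered_measure =
  fixes \<sigma> :: "real measure"
  assumes prob_sigma: "prob_space \<sigma>" and sets_sigma [measurable_cong]: "sets \<sigma> = sets borel"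
begin

sublocale prob_space \<sigma> by (rule prob_sigma)

sublocale fibers: sigma_finite_measure "count_space (UNIV :: 'k :: countable set)"
  by (rule sigma_finite_measure_count_space_countable) auto

sublocale pair: pair_sigma_finite "count_space (UNIV :: 'k :: countable set)" \<sigma> ..

lemma space_sigma [simp]: "space \<sigma> = UNIV"
  using sets_eq_imp_space_eq[OF sets_sigma] by simp

abbreviation fibered :: "('k :: countable \<times> real) measure" where
  "fibered \<equiv> count_space UNIV \<Otimes>\<^sub>M \<sigma>"

lemma measurable_fiberI:
  "(\<And>k. (\<lambda>r. g (k, r)) \<in> borel_measurable \<sigma>) \<Longrightarrow> g \<in> borel_measurable (fibered :: ('k :: countable \<times> real) measure)"
  by (rule measurable_pair_measure_countable1) auto

lemma AE_fibered:
  assumes "g \<in> borel_measurable (fibered :: ('k :: countable \<times> real) measure)"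
    and "\<And>k. AE r in \<sigma>. g (k, r) = (0 :: complex)"
  shows "AE x in fibered. g x = 0"
  by (rule pair.AE_pair_measure) (use assms in \<open>auto simp: AE_count_space\<close>)

lemma fiber_square_integrable:
  assumes "g \<in> square_integrable (fibered :: ('k :: countable \<times> real) measure)"
  shows "(\<lambda>r. g (k, r)) \<in> square_integrable \<sigma>"
proof -
  have "AE k in count_space UNIV. integrable \<sigma> (\<lambda>r. (cmod (g (k, r)))\<^sup>2)"
    by (rule pair.AE_integrable_fst') (rule square_integrable_norm[OF assms])
  moreover have "(\<lambda>r. g (k, r)) \<in> borel_measurable \<sigma>"
    using square_integrable_measurable[OF assms] by measurable
  ultimately show ?thesis by (simp add: AE_count_space square_integrable_def)
qed

lemma integral_single_fiber:
  fixes g :: "'k :: countable \<times> real \<Rightarrow> complex"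
  assumes g: "g \<in> square_integrable fibered" and B: "B \<in> sets \<sigma>"
  shows "(LINT x:{k} \<times> B|fibered. g x) = (LINT r:B|\<sigma>. g (k, r))"
proof -
  let ?F = "\<lambda>x. indicator ({k} \<times> B) x *\<^sub>R g x"
  have sets: "{k} \<times> B \<in> sets (fibered :: ('k \<times> real) measure)" using B by simp
  have fin: "emeasure (fibered :: ('k \<times> real) measure) ({k} \<times> B) < \<infinity>"
    using B by (simp add: emeasure_pair_measure_Times less_top[symmetric])
  have "integrable fibered ?F"
    using integrable_mult_cnj[OF g square_integrable_indicator[OF sets fin]]
    by (simp add: scaleR_conv_of_real mult.commute)
  then have "(LINT x:{k} \<times> B|fibered. g x) = (\<integral>k'. (\<integral>r. ?F (k', r) \<partial>\<sigma>) \<partial>count_space UNIV)"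
    unfolding set_lebesgue_integral_def by (rule pair.integral_fst'[symmetric])
  also have "\<dots> = (\<integral>k'. (if k' = k then LINT r:B|\<sigma>. g (k, r) else 0) \<partial>count_space UNIV)"
    by (rule Bochner_Integration.integral_cong)
       (auto simp: set_lebesgue_integral_def indicator_times)
  also have "\<dots> = (LINT r:B|\<sigma>. g (k, r))"
  proof -
    have "{k'. k' = k \<and> c \<noteq> 0} = (if c = 0 then {} else {k})" for c :: complex by auto
    then show ?thesis by (subst lebesgue_integral_count_space_finite_support) auto
  qed
  finally show ?thesis .
qed

text \<open>On each fiber the integrals over the rational half-lines determine the real and the imaginary
  part; as there are only countably many fibers, the exceptional null sets add up to a null
  set.\<close>

lemma coded_L2_fibered: "coded_L2 (fibered :: ('k :: countable \<times> real) measure) half_line_fiber"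
proof
  show "half_line_fiber n \<in> sets (fibered :: ('k :: countable \<times> real) measure)" for n
    by (auto simp: half_line_fiber_def sets_sigma split: prod.split)
  show "emeasure (fibered :: ('k :: countable \<times> real) measure) (half_line_fiber n) < \<infinity>" for n
    by (auto simp: half_line_fiber_def sets_sigma emeasure_pair_measure_Times less_top[symmetric]
        split: prod.split)
next
  fix g :: "'k :: countable \<times> real \<Rightarrow> complex"
  assume g: "g \<in> square_integrable fibered"
    and zero: "\<And>n. (LINT x:half_line_fiber n|fibered. g x) = 0"
  show "AE x in fibered. g x = 0"
  proof (rule AE_fibered)
    fix k
    note sq = fiber_square_integrable[OF g, of k]
    have int: "integrable \<sigma> (\<lambda>r. g (k, r))"
      using integrable_mult_cnj[OF sq, of "\<lambda>_. 1"] by (simp add: square_integrable_def)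
    have half: "(LINT r:{real_of_rat q<..}|\<sigma>. g (k, r)) = 0" for q
      using zero[of "to_nat (k, q)"] integral_single_fiber[OF g, of "{real_of_rat q<..}" k]
      by (simp add: half_line_fiber_to_nat sets_sigma)
    have sint: "integrable \<sigma> (\<lambda>r. indicator {real_of_rat q<..} r *\<^sub>R g (k, r))" for q
      by (rule integrable_mult_indicator[OF _ int]) (simp add: sets_sigma)
    have "AE r in \<sigma>. Re (g (k, r)) = 0"
    proof (rule AE_zero_of_half_line_integrals[OF _ sets_sigma])
      show "(LINT r:{real_of_rat q<..}|\<sigma>. Re (g (k, r))) = 0" for q
        using arg_cong[OF half[of q], of Re] integral_Re[OF sint[of q]]
        by (simp add: set_lebesgue_integral_def)
    qed (use int in \<open>auto intro: finite_measure_axioms\<close>)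
    moreover have "AE r in \<sigma>. Im (g (k, r)) = 0"
    proof (rule AE_zero_of_half_line_integrals[OF _ sets_sigma])
      show "(LINT r:{real_of_rat q<..}|\<sigma>. Im (g (k, r))) = 0" for q
        using arg_cong[OF half[of q], of Im] integral_Im[OF sint[of q]]
        by (simp add: set_lebesgue_integral_def)
    qed (use int in \<open>auto intro: finite_measure_axioms\<close>)
    ultimately show "AE r in \<sigma>. g (k, r) = 0"
      by eventually_elim (simp add: complex_eq_iff)
  qed (rule square_integrable_measurable[OF g])
qed

end

section \<open>The normal extension of a two-variable weighted shift\<close>

definition lattice_embedding :: "nat \<times> nat \<Rightarrow> int \<times> int" where
  "lattice_embedding = (\<lambda>(i, j). (int i, int j))"

lemma inj_lattice_embedding: "inj lattice_embedding"
  by (auto simp: inj_def lattice_embedding_def)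

lemma range_lattice_embedding: "range lattice_embedding = {k. 0 \<le> fst k \<and> 0 \<le> snd k}"
proof (intro set_eqI iffI)
  fix k :: "int \<times> int" assume "k \<in> {k. 0 \<le> fst k \<and> 0 \<le> snd k}"
  then have "k = lattice_embedding (nat (fst k), nat (snd k))"
    by (simp add: lattice_embedding_def prod_eq_iff)
  then show "k \<in> range lattice_embedding" by (rule range_eqI)
qed (auto simp: lattice_embedding_def)

lemma lattice_embedding_cases:
  obtains i j where "k = lattice_embedding (i, j)" | "k \<notin> range lattice_embedding"
  by (metis rangeE surj_pair)

definition translate :: "'k \<Rightarrow> 'k \<times> real \<Rightarrow> 'k :: {countable, ab_group_add} \<times> real" where
  "translate d = (\<lambda>(k, r). (k - d, r))"

context fibered_measure
begin

lemma measure_preserving_translate: "measure_preserving (fibered :: ('k :: {countable, ab_group_add} \<times> real) measure) (translate d)"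
proof -
  have d: "distr (count_space UNIV) (count_space UNIV) (\<lambda>k :: 'k. k - d) = count_space UNIV"
    by (rule distr_bij_count_space) (rule bij_diff_right)
  have s: "distr \<sigma> \<sigma> (\<lambda>r. r) = \<sigma>" by (rule distr_id)
  have "distr (count_space UNIV) (count_space UNIV) (\<lambda>k :: 'k. k - d) \<Otimes>\<^sub>M distr \<sigma> \<sigma> (\<lambda>r. r)
    = distr fibered fibered (\<lambda>(k, r). (k - d, r))"
    by (rule pair_measure_distr) (simp_all add: s sigma_finite_measure_axioms)
  then show ?thesis
    unfolding measure_preserving_def translate_def d s by simp
qed

end

text \<open>The functions \<open>a\<close> and \<open>b\<close> stand for the square roots of \<open>p\<close> and \<open>q\<close>; the moments then are the squared
  norms of \<open>a^i b^j\<close> in \<open>L\<^sup>2(\<sigma>)\<close>.\<close>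

locale shift_model = fibered_measure +
  fixes a b :: "real \<Rightarrow> real" and \<gamma> :: "nat \<Rightarrow> nat \<Rightarrow> real"
  assumes a_meas [measurable]: "a \<in> borel_measurable borel" and b_meas [measurable]: "b \<in> borel_measurable borel"
    and a_bounded: "bounded (range a)" and b_bounded: "bounded (range b)"
    and \<gamma>_pos: "0 < \<gamma> i j"
    and \<gamma>_integral: "\<gamma> i j = (\<integral>r. (a r ^ i * b r ^ j)\<^sup>2 \<partial>\<sigma>)"
begin

sublocale coded_L2 "fibered :: ((int \<times> int) \<times> real) measure" half_line_fiber
  by (rule coded_L2_fibered)

definition basis_function :: "nat \<Rightarrow> nat \<Rightarrow> real \<Rightarrow> real" where
  "basis_function i j r = a r ^ i * b r ^ j / sqrt (\<gamma> i j)"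

lemma basis_function_measurable [measurable]: "basis_function i j \<in> borel_measurable \<sigma>"
  unfolding basis_function_def[abs_def] measurable_cong_sets[OF sets_sigma refl] by measurable

lemma basis_function_integral:
  "integrable \<sigma> (\<lambda>r. (basis_function i j r)\<^sup>2)" "(\<integral>r. (basis_function i j r)\<^sup>2 \<partial>\<sigma>) = 1"
proof -
  have sq: "(basis_function i j r)\<^sup>2 = (a r ^ i * b r ^ j)\<^sup>2 / \<gamma> i j" for r
    using \<gamma>_pos[of i j] by (simp add: basis_function_def power_divide)
  show one: "(\<integral>r. (basis_function i j r)\<^sup>2 \<partial>\<sigma>) = 1"
    unfolding sq using \<gamma>_pos[of i j] by (simp add: \<gamma>_integral[of i j])
  show "integrable \<sigma> (\<lambda>r. (basis_function i j r)\<^sup>2)"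
    using one not_integrable_integral_eq by fastforce
qed

text \<open>The image of the unit vector at \<open>(i, j)\<close> lives on the fiber over \<open>(i, j)\<close>, where it is the
  normalised function \<open>a^i b^j\<close>. Different fibers make the images orthogonal.\<close>

definition spread :: "(nat \<times> nat \<Rightarrow> complex) \<Rightarrow> (int \<times> int) \<times> real \<Rightarrow> complex" where
  "spread x = (\<lambda>(k, r). if k \<in> range lattice_embedding
     then x (nat (fst k), nat (snd k)) * of_real (basis_function (nat (fst k)) (nat (snd k)) r) else 0)"

lemma spread_lattice: "spread x (lattice_embedding (i, j), r) = x (i, j) * of_real (basis_function i j r)"
proof -
  \<comment> \<open>The lattice point is kept abstract while the definition is unfolded, so that its membership
    in the range remains visible.\<close>
  have "spread x (k, r) = x (nat (fst k), nat (snd k)) * of_real (basis_function (nat (fst k)) (nat (snd k)) r)"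
    if "k = lattice_embedding (i, j)" for k
    using that by (auto simp: spread_def)
  from this[OF refl] show ?thesis by (simp add: lattice_embedding_def)
qed

lemma spread_outside: "k \<notin> range lattice_embedding \<Longrightarrow> spread x (k, r) = 0"
  by (simp add: spread_def)

lemma spread_measurable: "spread x \<in> borel_measurable fibered"
proof (rule measurable_fiberI)
  show "(\<lambda>r. spread x (k, r)) \<in> borel_measurable \<sigma>" for k
    by (cases k rule: lattice_embedding_cases) (simp_all add: spread_lattice spread_outside)
qed

lemma spread_square_integrable:
  assumes x: "x \<in> pts ell2"
  shows "spread x \<in> square_integrable fibered"
proof -
  note [measurable] = spread_measurable
  have fiber: "(\<integral>\<^sup>+r. ennreal ((cmod (spread x (lattice_embedding p, r)))\<^sup>2) \<partial>\<sigma>) = ennreal ((cmod (x p))\<^sup>2)" for p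
  proof -
    obtain i j where p: "p = (i, j)" by (cases p)
    have "(\<integral>\<^sup>+r. ennreal ((cmod (x p))\<^sup>2 * (basis_function i j r)\<^sup>2) \<partial>\<sigma>)
      = ennreal (\<integral>r. (cmod (x p))\<^sup>2 * (basis_function i j r)\<^sup>2 \<partial>\<sigma>)"
      by (rule nn_integral_eq_integral) (auto intro: basis_function_integral)
    then show ?thesis
      by (simp add: p spread_lattice norm_mult power_mult_distrib basis_function_integral)
  qed
  have "(\<integral>\<^sup>+y. ennreal ((cmod (spread x y))\<^sup>2) \<partial>fibered)
    = (\<integral>\<^sup>+k. (\<integral>\<^sup>+r. ennreal ((cmod (spread x (k, r)))\<^sup>2) \<partial>\<sigma>) \<partial>count_space UNIV)"
    by (rule nn_integral_fst[symmetric]) measurable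
  also have "\<dots> = (\<integral>\<^sup>+k. (\<integral>\<^sup>+r. ennreal ((cmod (spread x (k, r)))\<^sup>2) \<partial>\<sigma>) \<partial>count_space (range lattice_embedding))"
    by (rule nn_integral_count_space_eq) (auto simp: spread_outside)
  also have "\<dots> = (\<integral>\<^sup>+p. ennreal ((cmod (x p))\<^sup>2) \<partial>count_space UNIV)"
    by (subst nn_integral_bij_count_space[symmetric, of lattice_embedding UNIV])
       (auto simp: bij_betw_def inj_lattice_embedding fiber)
  also have "\<dots> < \<infinity>"
  proof -
    have "(\<lambda>p. (cmod (x p))\<^sup>2) summable_on UNIV" using x by (simp add: ell2_def)
    then have "integrable (count_space UNIV) (\<lambda>p. (cmod (x p))\<^sup>2)"
      using abs_summable_equivalent[of "\<lambda>p. (cmod (x p))\<^sup>2" UNIV]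
      by (simp add: Infinite_Set_Sum.abs_summable_on_def)
    then show ?thesis by (simp add: nn_integral_eq_integral)
  qed
  finally show ?thesis
    unfolding square_integrable_def by (auto intro!: integrableI_bounded)
qed

text \<open>Integrating over the fibers first reduces the claim to the sum that defines the inner product
  of \<^const>\<open>ell2\<close>, since \<^const>\<open>basis_function\<close> is normalised.\<close>

lemma spread_inner_product:
  assumes x: "x \<in> pts ell2" and y: "y \<in> pts ell2"
  shows "(\<integral>z. spread x z * cnj (spread y z) \<partial>fibered) = vip ell2 x y"
proof -
  let ?F = "\<lambda>z. spread x z * cnj (spread y z)"
  let ?H = "\<lambda>k. \<integral>r. ?F (k, r) \<partial>\<sigma>"
  have int: "integrable fibered ?F"
    by (rule integrable_mult_cnj) (intro spread_square_integrable x y)+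
  have H: "?H (lattice_embedding p) = x p * cnj (y p)" for p
  proof -
    obtain i j where p: "p = (i, j)" by (cases p)
    have "?H (lattice_embedding p) = (\<integral>r. x p * cnj (y p) * of_real ((basis_function i j r)\<^sup>2) \<partial>\<sigma>)"
      by (rule Bochner_Integration.integral_cong) (simp_all add: p spread_lattice power2_eq_square mult_ac)
    also have "\<dots> = x p * cnj (y p) * of_real (\<integral>r. (basis_function i j r)\<^sup>2 \<partial>\<sigma>)"
      by (simp only: integral_mult_right_zero integral_complex_of_real)
    finally show ?thesis by (simp add: basis_function_integral)
  qed
  have "integrable (count_space UNIV) ?H"
    by (rule pair.integrable_fst'[OF int])
  then have "infsetsum ?H UNIV = infsum ?H UNIV"
    by (intro infsetsum_infsum) (simp add: Infinite_Set_Sum.abs_summable_on_def)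
  moreover have "integral\<^sup>L fibered ?F = infsetsum ?H UNIV"
    unfolding infsetsum_def by (rule pair.integral_fst'[OF int, symmetric])
  moreover have "infsum ?H UNIV = infsum ?H (range lattice_embedding)"
    by (rule infsum_cong_neutral) (auto simp: spread_outside)
  moreover have "\<dots> = (\<Sum>\<^sub>\<infinity>p. x p * cnj (y p))"
    unfolding infsum_reindex[OF inj_lattice_embedding] comp_def H ..
  ultimately show ?thesis by (simp add: ell2_def)
qed

lemma multiplier_fiber:
  assumes "c \<in> borel_measurable borel" "bounded (range c)"
  shows "multiplier (fibered :: ((int \<times> int) \<times> real) measure) (\<lambda>(k, r). c r)"
proof -
  from assms(2) obtain C where "\<forall>r. \<bar>c r\<bar> \<le> C" by (auto simp: bounded_iff)
  moreover have "(\<lambda>(k, r). c r) \<in> borel_measurable fibered"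
    using assms(1) by (intro measurable_fiberI) (simp add: measurable_cong_sets[OF sets_sigma refl])
  ultimately show ?thesis by (auto simp: multiplier_def)
qed

definition normal_shift :: "(real \<Rightarrow> real) \<Rightarrow> int \<times> int \<Rightarrow> (nat \<Rightarrow> complex) \<Rightarrow> (nat \<Rightarrow> complex)" where
  "normal_shift c d = composition_operator (\<lambda>(k, r). c r) (translate d)"

lemma normal_normal_shift:
  assumes "c \<in> borel_measurable borel" "bounded (range c)"
  shows "normal_operator L2_space (normal_shift c d)"
  unfolding normal_shift_def
  by (rule normal_composition_operator[OF multiplier_fiber[OF assms] measure_preserving_translate
        measure_preserving_translate[of "- d"]]) (simp_all add: translate_def case_prod_unfold)

lemma normal_shifts_commute:
  assumes "c \<in> borel_measurable borel" "bounded (range c)" "c' \<in> borel_measurable borel" "bounded (range c')"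
  shows "operators_commute L2_space (normal_shift c d) (normal_shift c' d')"
  unfolding normal_shift_def
  by (rule commuting_composition_operators[OF multiplier_fiber measure_preserving_translate
        multiplier_fiber measure_preserving_translate])
     (use assms in \<open>auto simp: translate_def algebra_simps split: prod.split\<close>)

lemma normal_shift_code:
  assumes "c \<in> borel_measurable borel" "bounded (range c)" "g \<in> square_integrable fibered"
  shows "normal_shift c d (code g) = code (\<lambda>(k, r). of_real (c r) * g (k - d, r))"
proof -
  have "weighted_composition (\<lambda>(k, r). c r) (translate d) g = (\<lambda>(k, r). of_real (c r) * g (k - d, r))"
    by (auto simp: weighted_composition_def translate_def fun_eq_iff)
  then show ?thesis
    unfolding normal_shift_def
    using composition_operator_code(2)[OF multiplier_fiber[OF assms(1,2)] measure_preserving_translate assms(3)]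
    by simp
qed

lemma isometric_embedding_spread: "isometric_embedding ell2 L2_space (\<lambda>x. code (spread x))"
proof -
  have add: "spread (\<lambda>i. x i + y i) = (\<lambda>z. spread x z + spread y z)" for x y
    by (auto simp: spread_def fun_eq_iff distrib_right)
  have scale: "spread (\<lambda>i. c * x i) = (\<lambda>z. c * spread x z)" for c x
    by (auto simp: spread_def fun_eq_iff)
  have "linear_map ell2 L2_space (\<lambda>x. code (spread x))"
    unfolding linear_map_def
    by (auto simp: pts_L2_space spread_square_integrable vadd_code vscale_code)
       (simp_all add: ell2_def add scale)
  then show ?thesis
    unfolding isometric_embedding_def
    by (auto simp: vip_code spread_square_integrable spread_inner_product)
qed

text \<open>The square root of the recursion for \<open>\<gamma>\<close> says that
  \<open>\<alpha>\<^sub>i\<^sub>j\<close> times the next basis function is \<open>a\<close> times the present one. On the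
  column with first coordinate \<open>0\<close> both sides vanish, because the translation leaves the quadrant.\<close>

lemma spread_intertwines1:
  assumes "\<And>i j. 0 < \<alpha> (i, j)" "\<And>i j. \<gamma> (Suc i) j = (\<alpha> (i, j))\<^sup>2 * \<gamma> i j"
  shows "spread (shift1 \<alpha> x) = (\<lambda>(k, r). of_real (a r) * spread x (k - (1, 0), r))"
proof (clarify intro!: ext)
  fix m n :: int and r
  show "spread (shift1 \<alpha> x) ((m, n), r) = of_real (a r) * spread x ((m, n) - (1, 0), r)"
  proof (cases "(m, n)" rule: lattice_embedding_cases)
    case (1 i j)
    show ?thesis
    proof (cases i)
      case 0
      then have "(m, n) - (1, 0) \<notin> range lattice_embedding"
        using 1 unfolding range_lattice_embedding by (simp add: lattice_embedding_def)
      then show ?thesis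
        unfolding 1 spread_lattice using 1 0 by (simp add: spread_outside shift1_def)
    next
      case (Suc i')
      then have eq: "(m, n) - (1, 0) = lattice_embedding (i', j)"
        using 1 by (simp add: lattice_embedding_def)
      have "\<alpha> (i', j) * basis_function (Suc i') j r = a r * basis_function i' j r"
        using assms(1)[of i' j] by (simp add: basis_function_def assms(2) real_sqrt_mult)
      then have "complex_of_real (\<alpha> (i', j)) * complex_of_real (basis_function (Suc i') j r)
          = complex_of_real (a r) * complex_of_real (basis_function i' j r)"
        by (metis of_real_mult)
      then show ?thesis
        unfolding eq unfolding 1 spread_lattice by (simp add: Suc shift1_def mult_ac)
    qed
  next
    case 2
    then have "(m, n) - (1, 0) \<notin> range lattice_embedding"
      unfolding range_lattice_embedding by auto
    with 2 show ?thesis by (simp add: spread_outside)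
  qed
qed

lemma spread_intertwines2:
  assumes "\<And>i j. 0 < \<beta> (i, j)" "\<And>i j. \<gamma> i (Suc j) = (\<beta> (i, j))\<^sup>2 * \<gamma> i j"
  shows "spread (shift2 \<beta> x) = (\<lambda>(k, r). of_real (b r) * spread x (k - (0, 1), r))"
proof (clarify intro!: ext)
  fix m n :: int and r
  show "spread (shift2 \<beta> x) ((m, n), r) = of_real (b r) * spread x ((m, n) - (0, 1), r)"
  proof (cases "(m, n)" rule: lattice_embedding_cases)
    case (1 i j)
    show ?thesis
    proof (cases j)
      case 0
      then have "(m, n) - (0, 1) \<notin> range lattice_embedding"
        using 1 unfolding range_lattice_embedding by (simp add: lattice_embedding_def)
      then show ?thesis
        unfolding 1 spread_lattice using 1 0 by (simp add: spread_outside shift2_def)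
    next
      case (Suc j')
      then have eq: "(m, n) - (0, 1) = lattice_embedding (i, j')"
        using 1 by (simp add: lattice_embedding_def)
      have "\<beta> (i, j') * basis_function i (Suc j') r = b r * basis_function i j' r"
        using assms(1)[of i j'] by (simp add: basis_function_def assms(2) real_sqrt_mult)
      then have "complex_of_real (\<beta> (i, j')) * complex_of_real (basis_function i (Suc j') r)
          = complex_of_real (b r) * complex_of_real (basis_function i j' r)"
        by (metis of_real_mult)
      then show ?thesis
        unfolding eq unfolding 1 spread_lattice by (simp add: Suc shift2_def mult_ac)
    qed
  next
    case 2
    then have "(m, n) - (0, 1) \<notin> range lattice_embedding"
      unfolding range_lattice_embedding by auto
    with 2 show ?thesis by (simp add: spread_outside)
  qed
qed

theorem jointly_subnormal_shifts:
  assumes wf: "weight_families \<alpha> \<beta>" and \<gamma>: "\<And>i j. \<gamma> i j = moment2 \<alpha> \<beta> i j"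
  shows "jointly_subnormal TYPE(nat \<Rightarrow> complex) ell2 (shift1 \<alpha>) (shift2 \<beta>)"
proof -
  obtain A B where "\<And>k. \<bar>\<alpha> k\<bar> \<le> A" "\<And>k. \<bar>\<beta> k\<bar> \<le> B"
    using weight_families_bounded[OF wf] by blast
  then interpret T1: injective_shift "\<lambda>(i, j). (Suc i, j)" \<alpha> A "shift1 \<alpha>"
    + T2: injective_shift "\<lambda>(i, j). (i, Suc j)" \<beta> B "shift2 \<beta>"
    by (auto intro: injective_shift1 injective_shift2)
  have pos: "0 < \<alpha> k" "0 < \<beta> k" for k using wf unfolding weight_families_def by blast+
  have "code (spread (shift1 \<alpha> x)) = normal_shift a (1, 0) (code (spread x)) \<and>
    code (spread (shift2 \<beta> x)) = normal_shift b (0, 1) (code (spread x))" if "x \<in> pts ell2" for x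
    using spread_intertwines1[of \<alpha> x] spread_intertwines2[of \<beta> x]
    by (simp add: normal_shift_code a_bounded b_bounded spread_square_integrable that
        \<gamma> moment2_Suc_left[OF wf] moment2_Suc_right pos)
  then show ?thesis
    unfolding jointly_subnormal_def
    using T1.bounded_shift T2.bounded_shift shifts_commute[OF wf] complex_hilbert_space_L2
      isometric_embedding_spread normal_normal_shift[OF a_meas a_bounded]
      normal_normal_shift[OF b_meas b_bounded]
      normal_shifts_commute[OF a_meas a_bounded b_meas b_bounded]
    by (intro conjI exI[of _ "L2_space"] exI[of _ "\<lambda>x. code (spread x)"]
        exI[of _ "normal_shift a (1, 0)"] exI[of _ "normal_shift b (0, 1)"]) auto
qed

end

section \<open>Support and essential bounds of the Berger measure\<close>

text \<open>The complement of the support is a union of open null sets, and by the Lindelof property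
  countably many of them suffice.\<close>

lemma AE_in_closed_superset_of_support:
  assumes sets: "sets \<sigma> = sets borel" and I: "closed I" "measure_support \<sigma> \<subseteq> I"
  shows "AE r in \<sigma>. r \<in> I"
proof -
  let ?F = "{U :: real set. open U \<and> emeasure \<sigma> U = 0}"
  obtain F where F: "F \<subseteq> ?F" "countable F" "\<Union> F = \<Union> ?F"
    using Lindelof[of ?F] by auto
  have null: "(\<Union>U\<in>F. U) \<in> null_sets \<sigma>"
    by (rule null_sets_UN'[OF F(2)]) (use F(1) in \<open>auto simp: null_sets_def sets\<close>)
  show ?thesis
  proof (rule AE_I'[OF null], clarify)
    fix r assume "r \<notin> I"
    then have "r \<notin> measure_support \<sigma>" using I by auto
    then have "r \<in> \<Union> ?F" by (auto simp: measure_support_def not_gr_zero)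
    then show "r \<in> (\<Union>U\<in>F. U)" using F(3) by auto
  qed
qed

text \<open>For \<open>c > B\<close>, Markov's inequality for the power \<open>h^k\<close> gives \<open>P(h \<ge> c) \<le> (B/c)^k\<close>, which tends to \<open>0\<close>.\<close>

lemma (in prob_space) AE_le_of_moment_bounds:
  fixes h :: "'a \<Rightarrow> real"
  assumes B: "0 < B" and nonneg: "AE x in M. 0 \<le> h x" and [measurable]: "h \<in> borel_measurable M"
    and int: "\<And>k::nat. integrable M (\<lambda>x. h x ^ k)" and moments: "\<And>k::nat. (\<integral>x. h x ^ k \<partial>M) \<le> B ^ k"
  shows "AE x in M. h x \<le> B"
proof -
  have below: "AE x in M. h x < c" if c: "B < c" for c
  proof -
    have "prob {x \<in> space M. c \<le> h x} \<le> (B / c) ^ k" for k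
    proof -
      have "prob {x \<in> space M. c \<le> h x} \<le> prob {x \<in> space M. c ^ k \<le> h x ^ k}"
        using B c by (intro finite_measure_mono) (auto intro: power_mono)
      also have "\<dots> \<le> (\<integral>x. h x ^ k \<partial>M) / c ^ k"
        by (rule integral_Markov_inequality_measure[OF int sets.empty_sets])
           (use nonneg B c in \<open>auto elim: eventually_mono\<close>)
      also have "\<dots> \<le> (B / c) ^ k"
        using moments[of k] B c by (simp add: power_divide divide_right_mono)
      finally show ?thesis .
    qed
    moreover have "(\<lambda>k. (B / c) ^ k) \<longlonglongrightarrow> 0"
      using B c by (intro LIMSEQ_realpow_zero) auto
    ultimately have "prob {x \<in> space M. c \<le> h x} \<le> 0"
      by (intro LIMSEQ_le_const) auto
    then have "emeasure M {x \<in> space M. c \<le> h x} = 0"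
      by (simp add: emeasure_eq_measure measure_le_0_iff)
    then have "AE x in M. \<not> c \<le> h x"
      by (subst AE_iff_measurable[OF _ refl]) auto
    then show ?thesis by (simp add: not_le)
  qed
  have "AE x in M. \<forall>n::nat. h x < B + inverse (real (Suc n))"
    unfolding AE_all_countable by (auto intro!: below)
  then show ?thesis
  proof eventually_elim
    case (elim x)
    show ?case
    proof (rule field_le_epsilon)
      fix e :: real assume "0 < e"
      then obtain n where "inverse (real (Suc n)) < e" using reals_Archimedean by blast
      with elim[rule_format, of n] show "h x \<le> B + e" by linarith
    qed
  qed
qed

lemma (in injective_shift) squared_weights_prod_le:
  "(\<Prod>i<k. (w (e i))\<^sup>2) \<le> ((operator_norm ell2 S)\<^sup>2) ^ k"
proof -
  have "(\<Prod>i<k. (w (e i))\<^sup>2) \<le> (\<Prod>i<k. (operator_norm ell2 S)\<^sup>2)"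
  proof (rule prod_mono)
    fix i :: nat
    show "0 \<le> (w (e i))\<^sup>2 \<and> (w (e i))\<^sup>2 \<le> (operator_norm ell2 S)\<^sup>2"
      using power_mono[OF weight_le_operator_norm[of "e i"], of 2] by simp
  qed
  then show ?thesis by simp
qed

theorem theorem1p6:
  fixes \<omega> :: "nat \<Rightarrow> real" and \<sigma> :: "real measure" and I :: "real set"
    and p q :: "real poly" and \<alpha> \<beta> :: "nat \<times> nat \<Rightarrow> real"
    and f :: "real \<Rightarrow> real \<times> real"
  assumes "weight_sequence \<omega>"
    and "subnormal TYPE('u) ell2 (weighted_shift \<omega>)"
    and "berger_measure \<omega> \<sigma>"
    and "pq_embedding I p q \<sigma> \<alpha> \<beta>"
    and "f = (\<lambda>r. (poly p r, poly q r))"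
    and "\<forall>r \<in> measure_support \<sigma>. 0 \<le> poly p r \<and> 0 \<le> poly q r"
  shows "jointly_subnormal TYPE(nat \<Rightarrow> complex) ell2 (shift1 \<alpha>) (shift2 \<beta>) \<and>
         berger_measure2 \<alpha> \<beta> (distr \<sigma> borel f)"
proof -
  from \<open>berger_measure \<omega> \<sigma>\<close> obtain R where \<sigma>: "prob_space \<sigma>" "sets \<sigma> = sets borel"
    and R: "emeasure \<sigma> (- {0..R}) = 0"
    by (auto simp: berger_measure_def)
  from \<open>pq_embedding I p q \<sigma> \<alpha> \<beta>\<close>
  have I: "closed I" "measure_support \<sigma> \<subseteq> I" and nonneg: "\<And>r. r \<in> I \<Longrightarrow> 0 \<le> poly p r \<and> 0 \<le> poly q r"
    and wf: "weight_families \<alpha> \<beta>"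
    and moments: "\<And>i j. moment2 \<alpha> \<beta> i j = (LINT r:I|\<sigma>. poly p r ^ i * poly q r ^ j)"
    by (auto simp: pq_embedding_def)
  interpret fibered_measure \<sigma> by (rule fibered_measure.intro) (rule \<sigma>)+
  have borel_\<sigma>: "borel_measurable \<sigma> = (borel_measurable borel :: (real \<Rightarrow> 'z :: topological_space) set)"
    by (rule measurable_cong_sets[OF \<sigma>(2) refl])
  define J where "J = I \<inter> {0..R}"
  have J: "compact J" unfolding J_def by (intro closed_Int_compact I compact_Icc)
  have AE_J: "AE r in \<sigma>. r \<in> J"
  proof -
    have "AE r in \<sigma>. r \<notin> - {0..R}"
      by (rule AE_not_in) (simp add: null_sets_def \<sigma> R)
    with AE_in_closed_superset_of_support[OF \<sigma>(2) I] show ?thesis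
      by eventually_elim (simp add: J_def)
  qed
  \<comment> \<open>Cutting off outside the compact set \<open>J\<close> keeps the square roots bounded on the whole line and
    changes them only on a null set.\<close>
  define root_on where "root_on P r = (if r \<in> J then sqrt (poly P r) else 0)" for P r
  have root_meas: "root_on P \<in> borel_measurable borel" for P
  proof -
    have "J \<in> sets borel" using J by (simp add: borel_compact)
    moreover have "(\<lambda>r. sqrt (poly P r)) \<in> borel_measurable borel"
      by (intro borel_measurable_continuous_onI continuous_intros)
    ultimately show ?thesis unfolding root_on_def[abs_def] by measurable
  qed
  have root_bounded: "bounded (range (root_on P))" for P
  proof -
    have "compact ((\<lambda>r. sqrt (poly P r)) ` J)"
      by (intro compact_continuous_image J continuous_intros)
    then have "bounded (insert 0 ((\<lambda>r. sqrt (poly P r)) ` J))"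
      by (simp add: compact_imp_bounded)
    then show ?thesis by (rule bounded_subset) (auto simp: root_on_def)
  qed
  have moments_root: "moment2 \<alpha> \<beta> i j = (\<integral>r. (root_on p r ^ i * root_on q r ^ j)\<^sup>2 \<partial>\<sigma>)" for i j
    unfolding moments set_lebesgue_integral_def
  proof (rule integral_cong_AE)
    have "I \<in> sets borel" using I by simp
    moreover have "(\<lambda>r. poly p r ^ i * poly q r ^ j) \<in> borel_measurable borel"
      by (intro borel_measurable_continuous_onI continuous_intros)
    ultimately show "(\<lambda>r. indicat_real I r *\<^sub>R (poly p r ^ i * poly q r ^ j)) \<in> borel_measurable \<sigma>"
      unfolding borel_\<sigma> by measurable
    show "(\<lambda>r. (root_on p r ^ i * root_on q r ^ j)\<^sup>2) \<in> borel_measurable \<sigma>"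
      unfolding borel_\<sigma> using root_meas by measurable
    show "AE r in \<sigma>. indicat_real I r *\<^sub>R (poly p r ^ i * poly q r ^ j) = (root_on p r ^ i * root_on q r ^ j)\<^sup>2"
      using AE_J
    proof eventually_elim
      case (elim r)
      then have "r \<in> I" by (simp add: J_def)
      have "(sqrt x ^ n)\<^sup>2 = x ^ n" if "0 \<le> x" for x :: real and n
      using that by (metis power_commutes power_mult real_sqrt_pow2 mult.commute)
    with nonneg[OF \<open>r \<in> I\<close>] elim \<open>r \<in> I\<close> show ?case
      by (simp add: root_on_def power_mult_distrib)
    qed
  qed
  interpret shift_model \<sigma> "root_on p" "root_on q" "moment2 \<alpha> \<beta>"
    by standard (rule root_meas root_bounded moment2_pos[OF wf] moments_root)+
  have subnormal: "jointly_subnormal TYPE(nat \<Rightarrow> complex) ell2 (shift1 \<alpha>) (shift2 \<beta>)"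
    by (rule jointly_subnormal_shifts[OF wf refl])

  obtain A B where AB: "\<And>k. \<bar>\<alpha> k\<bar> \<le> A" "\<And>k. \<bar>\<beta> k\<bar> \<le> B"
    using weight_families_bounded[OF wf] by blast
  interpret T1: injective_shift "\<lambda>(i, j). (Suc i, j)" \<alpha> A "shift1 \<alpha>"
    by (rule injective_shift1) (rule AB)
  interpret T2: injective_shift "\<lambda>(i, j). (i, Suc j)" \<beta> B "shift2 \<beta>"
    by (rule injective_shift2) (rule AB)
  have pos: "0 < \<alpha> k" "0 < \<beta> k" for k using wf unfolding weight_families_def by blast+
  have root_square_le: "AE r in \<sigma>. (root_on P r)\<^sup>2 \<le> N\<^sup>2"
    if "0 < N" and bound: "\<And>k. (\<integral>r. ((root_on P r)\<^sup>2) ^ k \<partial>\<sigma>) \<le> (N\<^sup>2) ^ k" for P N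
  proof (rule AE_le_of_moment_bounds[OF _ _ _ _ bound])
    show "(\<lambda>r. (root_on P r)\<^sup>2) \<in> borel_measurable \<sigma>"
      unfolding borel_\<sigma> using root_meas by measurable
    show "integrable \<sigma> (\<lambda>r. ((root_on P r)\<^sup>2) ^ k)" for k
    proof -
      obtain C where C: "\<And>r. \<bar>root_on P r\<bar> \<le> C"
        using root_bounded[of P] by (auto simp: bounded_iff)
      have "(\<lambda>r. ((root_on P r)\<^sup>2) ^ k) \<in> borel_measurable \<sigma>"
        unfolding borel_\<sigma> using root_meas by measurable
      moreover have "norm (((root_on P r)\<^sup>2) ^ k) \<le> (C\<^sup>2) ^ k" for r
        using power_mono[OF C, of r "2 * k"] by (simp add: power_mult power_abs[symmetric] abs_mult)
      ultimately show ?thesis by (intro integrable_const_bound[where B="(C\<^sup>2) ^ k"]) auto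
    qed
  qed (use that in auto)
  have "AE r in \<sigma>. (root_on p r)\<^sup>2 \<le> (operator_norm ell2 (shift1 \<alpha>))\<^sup>2"
  proof (rule root_square_le)
    show "0 < operator_norm ell2 (shift1 \<alpha>)"
      using T1.weight_le_operator_norm[of "(0, 0)"] pos(1)[of "(0, 0)"] by linarith
    show "(\<integral>r. ((root_on p r)\<^sup>2) ^ k \<partial>\<sigma>) \<le> ((operator_norm ell2 (shift1 \<alpha>))\<^sup>2) ^ k" for k
      using T1.squared_weights_prod_le[of "\<lambda>i. (i, 0)" k] moments_root[of k 0]
      by (simp add: moment2_def power_mult[symmetric] mult.commute)
  qed
  moreover have "AE r in \<sigma>. (root_on q r)\<^sup>2 \<le> (operator_norm ell2 (shift2 \<beta>))\<^sup>2"
  proof (rule root_square_le)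
    show "0 < operator_norm ell2 (shift2 \<beta>)"
      using T2.weight_le_operator_norm[of "(0, 0)"] pos(2)[of "(0, 0)"] by linarith
    show "(\<integral>r. ((root_on q r)\<^sup>2) ^ k \<partial>\<sigma>) \<le> ((operator_norm ell2 (shift2 \<beta>))\<^sup>2) ^ k" for k
      using T2.squared_weights_prod_le[of "\<lambda>j. (0, j)" k] moments_root[of 0 k]
      by (simp add: moment2_def power_mult[symmetric] mult.commute)
  qed
  ultimately have AE_f: "AE r in \<sigma>. r \<in> I \<and> f r \<in> {0..(operator_norm ell2 (shift1 \<alpha>))\<^sup>2} \<times>
      {0..(operator_norm ell2 (shift2 \<beta>))\<^sup>2}"
    using AE_J
  proof eventually_elim
    case (elim r)
    then have "r \<in> I" by (simp add: J_def)
    with nonneg[OF this] elim show ?case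
      by (simp add: root_on_def \<open>f = _\<close>)
  qed
  have f_meas: "f \<in> borel_measurable \<sigma>"
    unfolding borel_\<sigma> \<open>f = _\<close>
    by (intro borel_measurable_continuous_onI continuous_intros)
  have "berger_measure2 \<alpha> \<beta> (distr \<sigma> borel f)"
    unfolding berger_measure2_def
  proof (intro conjI allI)
    show "prob_space (distr \<sigma> borel f)" by (rule prob_space_distr[OF f_meas])
    let ?Q = "{0..(operator_norm ell2 (shift1 \<alpha>))\<^sup>2} \<times> {0..(operator_norm ell2 (shift2 \<beta>))\<^sup>2}"
    have Q: "- ?Q \<in> sets borel"
      by (intro borel_open open_Compl closed_Times closed_atLeastAtMost)
    have "emeasure (distr \<sigma> borel f) (- ?Q) = emeasure \<sigma> (f -` (- ?Q) \<inter> space \<sigma>)"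
      by (rule emeasure_distr[OF f_meas Q])
    also have "\<dots> = 0"
    proof -
      have "AE r in \<sigma>. f r \<in> ?Q" using AE_f by eventually_elim simp
      moreover have "f -` (- ?Q) \<inter> space \<sigma> \<in> sets \<sigma>" by (rule measurable_sets[OF f_meas Q])
      ultimately show ?thesis
        by (subst (asm) AE_iff_measurable[where N="f -` (- ?Q) \<inter> space \<sigma>"]) auto
    qed
    finally show "emeasure (distr \<sigma> borel f) (- ?Q) = 0" .
    fix i j
    have "(\<lambda>z. fst z ^ i * snd z ^ j) \<in> borel_measurable (borel :: (real \<times> real) measure)"
      by (intro borel_measurable_continuous_onI continuous_intros)
    then have "(\<integral>(s, t). s ^ i * t ^ j \<partial>distr \<sigma> borel f) = (\<integral>r. poly p r ^ i * poly q r ^ j \<partial>\<sigma>)"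
      using integral_distr[OF f_meas, of "\<lambda>z. fst z ^ i * snd z ^ j"]
      by (simp add: case_prod_unfold \<open>f = _\<close>)
    also have "\<dots> = moment2 \<alpha> \<beta> i j"
      unfolding moments set_lebesgue_integral_def
    proof (rule integral_cong_AE)
      show m: "(\<lambda>r. poly p r ^ i * poly q r ^ j) \<in> borel_measurable \<sigma>"
        unfolding borel_\<sigma> by (intro borel_measurable_continuous_onI continuous_intros)
      have "I \<in> sets \<sigma>" using I by (simp add: \<sigma>)
      with m show "(\<lambda>r. indicat_real I r *\<^sub>R (poly p r ^ i * poly q r ^ j)) \<in> borel_measurable \<sigma>"
        by measurable
    qed (use AE_f in \<open>auto elim: eventually_mono\<close>)
    finally show "moment2 \<alpha> \<beta> i j = (\<integral>(s, t). s ^ i * t ^ j \<partial>distr \<sigma> borel f)" by simp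
  qed simp
  with subnormal show ?thesis by blast
qed

end
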